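(* Every left-ordered inp-minimal group is abelian. That is, let $G$ be a first-order structure (possibly with further structure) whose universe carries a definable group operation $\cdot$ and a definable left-ordering $<$ of the group $(G,\cdot)$. If the complete theory $\mathrm{Th}(G)$ is inp-minimal, then the group $(G,\cdot)$ is abelian.
   Context: A left-ordering on a group $(G,\cdot)$ is a total ordering $<$ on $G$ such that for all $f,g,h\in G$, $g<h$ implies $f\cdot g<f\cdot h$. Let $T$ be a complete first-order theory and $\pi(\overline{x})$ a partial type. An inp-pattern of depth $\kappa$ in $\pi(\overline{x})$ is a sequence of formulas $\langle \varphi_i(\overline{x};\overline{y}_i): i<\kappa\rangle$ together with an array of parameters $\{\overline{a}_{i,j}: i<\kappa, j<\omega\}$ from some model of $T$ such that: (a) for each $i<\kappa$ there is $k_i<\omega$ such that $\{\varphi_i(\overline{x};\overline{a}_{i,j}): j<\omega\}$ is $k_i$-inconsistent (every subset consisting of the formulas for $k_i$ distinct indices $j$ is inconsistent); and (b) for each $\eta:\kappa\to\omega$, the partial type $\pi(\overline{x})\cup\{\varphi_i(\overline{x};\overline{a}_{i,\eta(i)}): i<\kappa\}$ is consistent. The inp-rank (or burden) of $\pi(\overline{x})$ is the maximal $\kappa$ such that there is an inp-pattern of depth $\kappa$ in $\pi(\overline{x})$, if such a maximum exists. The inp-rank of $T$ is the inp-rank of $x=x$, where $x$ is a single variable. $T$ is inp-minimal if its inp-rank is $1$; a structure is called inp-minimal if its complete theory is. *)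

theory Defs
  imports "HOL-Algebra.Group"
begin

section \<open>First-order logic\<close>

text \<open>A language is a set of function symbols together with a set of relation symbols, each symbol
  coming with its arity; constants are function symbols of arity 0. Terms and formulas of the two
  datatypes below need not belong to a given language; membership is expressed by \<open>wf_tm\<close>, \<open>wf_fm\<close>.\<close>

type_synonym ('f, 'r) language = "('f \<times> nat) set \<times> ('r \<times> nat) set"

datatype 'f tm = TVar nat | TApp 'f "'f tm list"

datatype ('f, 'r) fm =
    Equal "'f tm" "'f tm"
  | Rel 'r "'f tm list"
  | Neg "('f, 'r) fm"
  | Conj "('f, 'r) fm" "('f, 'r) fm"
  | Exists nat "('f, 'r) fm"

primrec wf_tm :: "('f, 'r) language \<Rightarrow> 'f tm \<Rightarrow> bool" where
  "wf_tm L (TVar i) \<longleftrightarrow> True"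
| "wf_tm L (TApp f ts) \<longleftrightarrow> (f, length ts) \<in> fst L \<and> list_all (wf_tm L) ts"

primrec wf_fm :: "('f, 'r) language \<Rightarrow> ('f, 'r) fm \<Rightarrow> bool" where
  "wf_fm L (Equal s t) \<longleftrightarrow> wf_tm L s \<and> wf_tm L t"
| "wf_fm L (Rel r ts) \<longleftrightarrow> (r, length ts) \<in> snd L \<and> list_all (wf_tm L) ts"
| "wf_fm L (Neg \<phi>) \<longleftrightarrow> wf_fm L \<phi>"
| "wf_fm L (Conj \<phi> \<psi>) \<longleftrightarrow> wf_fm L \<phi> \<and> wf_fm L \<psi>"
| "wf_fm L (Exists i \<phi>) \<longleftrightarrow> wf_fm L \<phi>"

primrec fv_tm :: "'f tm \<Rightarrow> nat set" where
  "fv_tm (TVar i) = {i}"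
| "fv_tm (TApp f ts) = \<Union> (set (map fv_tm ts))"

primrec fv :: "('f, 'r) fm \<Rightarrow> nat set" where
  "fv (Equal s t) = fv_tm s \<union> fv_tm t"
| "fv (Rel r ts) = \<Union> (fv_tm ` set ts)"
| "fv (Neg \<phi>) = fv \<phi>"
| "fv (Conj \<phi> \<psi>) = fv \<phi> \<union> fv \<psi>"
| "fv (Exists i \<phi>) = fv \<phi> - {i}"

record ('u, 'f, 'r) fo_struct =
  univ :: "'u set"
  fn_interp :: "'f \<Rightarrow> 'u list \<Rightarrow> 'u"
  rel_interp :: "'r \<Rightarrow> 'u list \<Rightarrow> bool"

definition is_struct :: "('f, 'r) language \<Rightarrow> ('u, 'f, 'r) fo_struct \<Rightarrow> bool" where
  "is_struct L M \<longleftrightarrow> univ M \<noteq> {} \<and>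
     (\<forall>(f, n) \<in> fst L. \<forall>as. length as = n \<and> set as \<subseteq> univ M \<longrightarrow> fn_interp M f as \<in> univ M)"

primrec eval_tm :: "('u, 'f, 'r) fo_struct \<Rightarrow> (nat \<Rightarrow> 'u) \<Rightarrow> 'f tm \<Rightarrow> 'u" where
  "eval_tm M e (TVar i) = e i"
| "eval_tm M e (TApp f ts) = fn_interp M f (map (eval_tm M e) ts)"

primrec sat :: "('u, 'f, 'r) fo_struct \<Rightarrow> (nat \<Rightarrow> 'u) \<Rightarrow> ('f, 'r) fm \<Rightarrow> bool" where
  "sat M e (Equal s t) \<longleftrightarrow> eval_tm M e s = eval_tm M e t"
| "sat M e (Rel r ts) \<longleftrightarrow> rel_interp M r (map (eval_tm M e) ts)"
| "sat M e (Neg \<phi>) \<longleftrightarrow> \<not> sat M e \<phi>"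
| "sat M e (Conj \<phi> \<psi>) \<longleftrightarrow> sat M e \<phi> \<and> sat M e \<psi>"
| "sat M e (Exists i \<phi>) \<longleftrightarrow> (\<exists>b \<in> univ M. sat M (e(i := b)) \<phi>)"

definition true_in :: "('u, 'f, 'r) fo_struct \<Rightarrow> ('f, 'r) fm \<Rightarrow> bool" where
  "true_in M \<phi> \<longleftrightarrow> (\<forall>e. range e \<subseteq> univ M \<longrightarrow> sat M e \<phi>)"

definition Th :: "('f, 'r) language \<Rightarrow> ('u, 'f, 'r) fo_struct \<Rightarrow> ('f, 'r) fm set" where
  "Th L M = {\<phi>. wf_fm L \<phi> \<and> fv \<phi> = {} \<and> true_in M \<phi>}"

definition models :: "('f, 'r) language \<Rightarrow> ('f, 'r) fm set \<Rightarrow> ('u, 'f, 'r) fo_struct \<Rightarrow> bool" where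
  "models L T M \<longleftrightarrow> is_struct L M \<and> (\<forall>\<phi> \<in> T. true_in M \<phi>)"

text \<open>In a formula \<open>\<phi>(x; y)\<close> with \<open>n\<close> object variables and \<open>m\<close> parameter variables, the object
  variables are \<open>0, \<dots>, n - 1\<close> and the parameter variables are \<open>n, \<dots>, n + m - 1\<close>.
  Substituting \<open>b\<close> for \<open>x\<close> and \<open>a\<close> for \<open>y\<close> is therefore evaluation under the assignment
  \<open>(!) (b @ a)\<close>, whose values at the other variables are irrelevant.\<close>

definition partitioned_fm :: "('f, 'r) language \<Rightarrow> nat \<Rightarrow> nat \<Rightarrow> ('f, 'r) fm \<Rightarrow> bool" where
  "partitioned_fm L n m \<phi> \<longleftrightarrow> wf_fm L \<phi> \<and> fv \<phi> \<subseteq> {..<n + m}"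

text \<open>Definable means definable with parameters.\<close>

definition definable ::
    "('f, 'r) language \<Rightarrow> ('u, 'f, 'r) fo_struct \<Rightarrow> nat \<Rightarrow> 'u list set \<Rightarrow> bool" where
  "definable L M n X \<longleftrightarrow> (\<exists>\<phi> c. partitioned_fm L n (length c) \<phi> \<and> set c \<subseteq> univ M \<and>
     X = {b. length b = n \<and> set b \<subseteq> univ M \<and> sat M ((!) (b @ c)) \<phi>})"


section \<open>Inp-patterns and inp-minimality\<close>

text \<open>A pair \<open>(\<phi>, a)\<close> stands for the formula \<open>\<phi>(x; a)\<close> over \<open>M\<close>. As usual, a set of such formulas
  is consistent (with the elementary diagram of \<open>M\<close>) if it is finitely satisfiable in \<open>M\<close>.\<close>

definition consistent ::
    "('u, 'f, 'r) fo_struct \<Rightarrow> nat \<Rightarrow> (('f, 'r) fm \<times> 'u list) set \<Rightarrow> bool" where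
  "consistent M n \<Gamma> \<longleftrightarrow> (\<forall>\<Delta>. \<Delta> \<subseteq> \<Gamma> \<and> finite \<Delta> \<longrightarrow>
     (\<exists>b. length b = n \<and> set b \<subseteq> univ M \<and> (\<forall>(\<phi>, a) \<in> \<Delta>. sat M ((!) (b @ a)) \<phi>)))"

definition k_inconsistent ::
    "('u, 'f, 'r) fo_struct \<Rightarrow> nat \<Rightarrow> nat \<Rightarrow> ('f, 'r) fm \<Rightarrow> (nat \<Rightarrow> 'u list) \<Rightarrow> bool" where
  "k_inconsistent M n k \<phi> a \<longleftrightarrow>
     (\<forall>J. finite J \<and> card J = k \<longrightarrow> \<not> consistent M n ((\<lambda>j. (\<phi>, a j)) ` J))"

text \<open>The order of the rows of an inp-pattern plays no role, so that a pattern of depth \<open>\<kappa>\<close> is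
  indexed by an arbitrary set \<open>I\<close> of cardinality \<open>\<kappa>\<close>. The partial type \<open>\<pi>\<close> in \<open>n\<close> variables is a
  set of \<open>L\<close>-formulas (without parameters).\<close>

definition inp_pattern ::
    "('f, 'r) language \<Rightarrow> ('f, 'r) fm set \<Rightarrow> nat \<Rightarrow> ('f, 'r) fm set \<Rightarrow> 'i set \<Rightarrow>
     ('u, 'f, 'r) fo_struct \<Rightarrow> ('i \<Rightarrow> ('f, 'r) fm) \<Rightarrow> ('i \<Rightarrow> nat) \<Rightarrow> ('i \<Rightarrow> nat \<Rightarrow> 'u list) \<Rightarrow> bool" where
  "inp_pattern L T n \<pi> I M \<phi> m a \<longleftrightarrow>
     models L T M \<and>
     (\<forall>i \<in> I. partitioned_fm L n (m i) (\<phi> i) \<and>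
        (\<forall>j. length (a i j) = m i \<and> set (a i j) \<subseteq> univ M)) \<and>
     (\<forall>i \<in> I. \<exists>k. k_inconsistent M n k (\<phi> i) (a i)) \<and>
     (\<forall>\<eta> :: 'i \<Rightarrow> nat. consistent M n
        ((\<lambda>\<psi>. (\<psi>, [])) ` \<pi> \<union> (\<lambda>i. (\<phi> i, a i (\<eta> i))) ` I))"

text \<open>Models are taken with universe a subset of the type \<open>('f, 'r) fm\<close>, which merely serves as a set
  of cardinality at least \<open>|L| + \<aleph>\<^sub>0\<close>. For countable depth this is no restriction: a pattern in
  an arbitrary model of \<open>T\<close> involves only countably many parameters, hence by downward
  Loewenheim-Skolem it lives in an elementary submodel of cardinality at most \<open>|L| + \<aleph>\<^sub>0\<close>.\<close>

definition has_inp_pattern ::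
    "('f, 'r) language \<Rightarrow> ('f, 'r) fm set \<Rightarrow> nat \<Rightarrow> ('f, 'r) fm set \<Rightarrow> nat set \<Rightarrow> bool" where
  "has_inp_pattern L T n \<pi> I \<longleftrightarrow>
     (\<exists>(M :: (('f, 'r) fm, 'f, 'r) fo_struct) \<phi> m a. inp_pattern L T n \<pi> I M \<phi> m a)"

text \<open>The inp-rank of \<open>\<pi>\<close> equals the finite cardinal \<open>d\<close>. It suffices to compare \<open>d\<close> with countable
  depths, since the rows of an inp-pattern may be restricted to any subset.\<close>

definition inp_rank_eq ::
    "('f, 'r) language \<Rightarrow> ('f, 'r) fm set \<Rightarrow> nat \<Rightarrow> ('f, 'r) fm set \<Rightarrow> nat \<Rightarrow> bool" where
  "inp_rank_eq L T n \<pi> d \<longleftrightarrow> has_inp_pattern L T n \<pi> {..<d} \<and>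
     (\<forall>I. has_inp_pattern L T n \<pi> I \<longrightarrow> finite I \<and> card I \<le> d)"

definition inp_minimal :: "('f, 'r) language \<Rightarrow> ('f, 'r) fm set \<Rightarrow> bool" where
  "inp_minimal L T \<longleftrightarrow> inp_rank_eq L T 1 {Equal (TVar 0) (TVar 0)} 1"


section \<open>Left-orderings\<close>

definition left_ordering :: "('a, 'b) monoid_scheme \<Rightarrow> ('a \<Rightarrow> 'a \<Rightarrow> bool) \<Rightarrow> bool" where
  "left_ordering G lt \<longleftrightarrow>
     irreflp_on (carrier G) lt \<and> transp_on (carrier G) lt \<and> totalp_on (carrier G) lt \<and>
     (\<forall>f \<in> carrier G. \<forall>g \<in> carrier G. \<forall>h \<in> carrier G.
        lt g h \<longrightarrow> lt (f \<otimes>\<^bsub>G\<^esub> g) (f \<otimes>\<^bsub>G\<^esub> h))"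

end

theory Submission
  imports Defs "HOL-Algebra.Generated_Groups" "HOL-Library.Countable_Set" "HOL-Library.Disjoint_Sets"
begin

text \<open>Two definable families of pairwise disjoint sets, each member of the first meeting each member
  of the second, form an inp-pattern of depth 2. For \<open>a\<close>, \<open>b\<close> the cosets \<open>a\<^sup>i C(b)\<close> and
  \<open>C(a) b\<^sup>j\<close> share \<open>a\<^sup>i b\<^sup>j\<close>, so some positive power of one of \<open>a\<close>, \<open>b\<close> commutes with the other.

  Let \<open>z\<close> be positive and let \<open>H\<close> be the intersection of \<open>C(z)\<close> with the convex hull of the powers
  of \<open>z\<close>. For \<open>x\<close>, \<open>y\<close> in \<open>H\<close> each coset \<open>x\<^sup>i C(y)\<close> is invariant under right translation by \<open>z\<close>,
  hence meets every half-open interval between consecutive powers of \<open>z\<close>; so some positive power of \<open>x\<close> commutes with \<open>y\<close>.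
  Since an element of a left-ordered group has the sign of its positive powers, conjugation
  within \<open>H\<close> preserves positivity, that is, \<open>H\<close> is bi-ordered and roots in \<open>H\<close> are unique.

  Finally let \<open>a\<^sup>n\<close> commute with \<open>b\<close>, where \<open>a\<close> is positive without loss of generality, and let
  \<open>z = a\<^sup>n\<close>. Then \<open>a\<close> and its conjugate by \<open>b\<close> are both \<open>n\<close>-th roots of \<open>z\<close>, hence both lie in
  \<open>H\<close> and are equal.\<close>

section \<open>Renaming of variables\<close>

lemma eval_tm_cong: "(\<And>i. i \<in> fv_tm t \<Longrightarrow> e i = e' i) \<Longrightarrow> eval_tm M e t = eval_tm M e' t"
proof (induction t)
  case (TApp f ts)
  have "map (eval_tm M e) ts = map (eval_tm M e') ts"
    using TApp by (intro map_cong) auto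
  then show ?case by (simp del: map_eq_conv)
qed simp

lemma sat_cong: "(\<And>i. i \<in> fv \<phi> \<Longrightarrow> e i = e' i) \<Longrightarrow> sat M e \<phi> \<longleftrightarrow> sat M e' \<phi>"
proof (induction \<phi> arbitrary: e e')
  case (Equal s t)
  have "eval_tm M e s = eval_tm M e' s" "eval_tm M e t = eval_tm M e' t"
    using Equal by (auto intro!: eval_tm_cong)
  then show ?case by simp
next
  case (Rel r ts)
  have "map (eval_tm M e) ts = map (eval_tm M e') ts"
    using Rel by (intro map_cong) (auto intro!: eval_tm_cong)
  then show ?case by (simp del: map_eq_conv)
next
  case (Neg \<phi>)
  have "sat M e \<phi> \<longleftrightarrow> sat M e' \<phi>" using Neg.prems by (intro Neg.IH) auto
  then show ?case by simp
next
  case (Conj \<phi> \<psi>)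
  have "sat M e \<phi> \<longleftrightarrow> sat M e' \<phi>" using Conj.prems by (intro Conj.IH(1)) auto
  moreover have "sat M e \<psi> \<longleftrightarrow> sat M e' \<psi>" using Conj.prems by (intro Conj.IH(2)) auto
  ultimately show ?case by simp
next
  case (Exists i \<phi>)
  have "sat M (e(i := b)) \<phi> \<longleftrightarrow> sat M (e'(i := b)) \<phi>" for b
    using Exists.prems by (intro Exists.IH) auto
  then show ?case by simp
qed

lemma finite_fv_tm: "finite (fv_tm t)"
  by (induction t) auto

lemma finite_fv: "finite (fv \<phi>)"
  by (induction \<phi>) (auto simp: finite_fv_tm)

primrec rename_tm :: "(nat \<Rightarrow> nat) \<Rightarrow> 'f tm \<Rightarrow> 'f tm" where
  "rename_tm \<sigma> (TVar i) = TVar (\<sigma> i)"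
| "rename_tm \<sigma> (TApp f ts) = TApp f (map (rename_tm \<sigma>) ts)"

text \<open>Bound variables are renamed along with the free ones, so an injective
  \<open>\<sigma>\<close> causes no capture and no fresh variables have to be chosen.\<close>

primrec rename_fm :: "(nat \<Rightarrow> nat) \<Rightarrow> ('f, 'r) fm \<Rightarrow> ('f, 'r) fm" where
  "rename_fm \<sigma> (Equal s t) = Equal (rename_tm \<sigma> s) (rename_tm \<sigma> t)"
| "rename_fm \<sigma> (Rel r ts) = Rel r (map (rename_tm \<sigma>) ts)"
| "rename_fm \<sigma> (Neg \<phi>) = Neg (rename_fm \<sigma> \<phi>)"
| "rename_fm \<sigma> (Conj \<phi> \<psi>) = Conj (rename_fm \<sigma> \<phi>) (rename_fm \<sigma> \<psi>)"
| "rename_fm \<sigma> (Exists i \<phi>) = Exists (\<sigma> i) (rename_fm \<sigma> \<phi>)"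

lemma wf_rename_tm: "wf_tm L (rename_tm \<sigma> t) \<longleftrightarrow> wf_tm L t"
  by (induction t) (auto simp: list_all_iff)

lemma wf_rename_fm: "wf_fm L (rename_fm \<sigma> \<phi>) \<longleftrightarrow> wf_fm L \<phi>"
  by (induction \<phi>) (auto simp: list_all_iff wf_rename_tm)

lemma fv_rename_tm: "fv_tm (rename_tm \<sigma> t) = \<sigma> ` fv_tm t"
  by (induction t) auto

lemma fv_rename_fm: "inj \<sigma> \<Longrightarrow> fv (rename_fm \<sigma> \<phi>) = \<sigma> ` fv \<phi>"
  by (induction \<phi>) (auto simp: fv_rename_tm image_Un image_set_diff)

lemma eval_rename_tm: "eval_tm M e (rename_tm \<sigma> t) = eval_tm M (\<lambda>i. e (\<sigma> i)) t"
proof (induction t)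
  case (TApp f ts)
  have "map (eval_tm M e \<circ> rename_tm \<sigma>) ts = map (eval_tm M (\<lambda>i. e (\<sigma> i))) ts"
    using TApp by (intro map_cong) simp_all
  then show ?case by (simp del: map_eq_conv)
qed simp

lemma sat_rename_fm: "inj \<sigma> \<Longrightarrow> sat M e (rename_fm \<sigma> \<phi>) \<longleftrightarrow> sat M (\<lambda>i. e (\<sigma> i)) \<phi>"
proof (induction \<phi> arbitrary: e)
  case (Exists i \<phi>)
  have "(\<lambda>j. (e(\<sigma> i := b)) (\<sigma> j)) = (\<lambda>j. e (\<sigma> j))(i := b)" for b
    using Exists.prems by (auto simp: fun_eq_iff inj_def)
  then show ?case using Exists by (simp del: fun_upd_apply)
qed (auto simp: eval_rename_tm comp_def)

text \<open>Bound variables may lie outside \<open>{..<K}\<close>, and \<open>rename_fm\<close>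
  behaves well only for a map injective on all of \<open>nat\<close>. So \<open>f\<close> is
  extended to such a map, which agrees with \<open>f\<close> on the free variables of
  \<open>\<phi>\<close>.\<close>

lemma exists_renaming:
  assumes "wf_fm L \<phi>" "fv \<phi> \<subseteq> {..<K}" "inj_on f {..<K}"
  obtains \<psi> where "wf_fm L \<psi>" "fv \<psi> = f ` fv \<phi>" "\<And>M e. sat M e \<psi> \<longleftrightarrow> sat M (\<lambda>i. e (f i)) \<phi>"
proof -
  \<comment> \<open>\<open>sum f {..<K}\<close> bounds every \<open>f n\<close> with
    \<open>n < K\<close>, so the remaining indices land strictly above all these values.\<close>
  define \<sigma> where "\<sigma> n = (if n < K then f n else sum f {..<K} + n + 1)" for n
  have bound: "f n \<le> sum f {..<K}" if "n < K" for n
    using that by (intro member_le_sum) auto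
  have inj: "inj \<sigma>"
  proof (rule injI)
    fix x y assume "\<sigma> x = \<sigma> y"
    then show "x = y"
      using bound[of x] bound[of y] inj_onD[OF assms(3), of x y]
      by (auto simp: \<sigma>_def split: if_splits)
  qed
  show ?thesis
  proof (rule that[of "rename_fm \<sigma> \<phi>"])
    show "wf_fm L (rename_fm \<sigma> \<phi>)" using assms by (simp add: wf_rename_fm)
    show "fv (rename_fm \<sigma> \<phi>) = f ` fv \<phi>"
      using assms(2) unfolding fv_rename_fm[OF inj] by (intro image_cong) (auto simp: \<sigma>_def)
    show "sat M e (rename_fm \<sigma> \<phi>) \<longleftrightarrow> sat M (\<lambda>i. e (f i)) \<phi>" for M :: "('x, 'a, 'b) fo_struct" and e
      unfolding sat_rename_fm[OF inj] using assms(2) by (intro sat_cong) (auto simp: \<sigma>_def)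
  qed
qed

section \<open>The downward Loewenheim-Skolem theorem\<close>

text \<open>The default \<open>e 0\<close> is a value of the assignment, so an assignment into the
  universe gives a result in the universe whatever \<open>\<phi>\<close> is.\<close>

definition witness :: "('u, 'f, 'r) fo_struct \<Rightarrow> (nat \<Rightarrow> 'u) \<Rightarrow> ('f, 'r) fm \<Rightarrow> 'u" where
  "witness M e \<phi> = (case \<phi> of
      Exists i \<psi> \<Rightarrow> (if sat M e (Exists i \<psi>) then SOME b. b \<in> univ M \<and> sat M (e(i := b)) \<psi> else e 0)
    | _ \<Rightarrow> e 0)"

text \<open>Formulas serve as names for the elements of a Skolem hull: \<open>Equal (TVar n) t\<close> names the generator
  \<open>p n\<close>, and \<open>Conj \<phi> \<psi>\<close> names a witness for the formula \<open>\<phi>\<close> under the assignment coded by \<open>\<psi>\<close>.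
  Read as an assignment, \<open>Conj \<phi> \<psi>\<close> is a list cell with head the element named by \<open>\<phi>\<close>. This makes the
  hull an image of the type of formulas without any cardinal arithmetic.\<close>

primrec decode :: "('u, 'f, 'r) fo_struct \<Rightarrow> (nat \<Rightarrow> 'u) \<Rightarrow> ('f, 'r) fm \<Rightarrow> 'u \<times> (nat \<Rightarrow> 'u)" where
  "decode M p (Equal s t) = (p (case s of TVar n \<Rightarrow> n | _ \<Rightarrow> 0), \<lambda>_. p 0)"
| "decode M p (Rel r ts) = (p 0, \<lambda>_. p 0)"
| "decode M p (Neg \<phi>) = (p 0, \<lambda>_. p 0)"
| "decode M p (Conj \<phi> \<psi>) =
     (witness M (snd (decode M p \<psi>)) \<phi>, case_nat (fst (decode M p \<phi>)) (snd (decode M p \<psi>)))"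
| "decode M p (Exists i \<phi>) = (p 0, \<lambda>_. p 0)"

lemma witness_Exists:
  assumes "sat M e (Exists i \<psi>)"
  shows "witness M e (Exists i \<psi>) \<in> univ M \<and> sat M (e(i := witness M e (Exists i \<psi>))) \<psi>"
proof -
  have "\<exists>b. b \<in> univ M \<and> sat M (e(i := b)) \<psi>" using assms by auto
  from someI_ex[OF this] show ?thesis using assms by (simp add: witness_def)
qed

lemma witness_in_univ: "range e \<subseteq> univ M \<Longrightarrow> witness M e \<phi> \<in> univ M"
proof (cases "\<exists>i \<psi>. \<phi> = Exists i \<psi> \<and> sat M e \<phi>")
  case True
  then show ?thesis using witness_Exists by blast
next
  case False
  assume "range e \<subseteq> univ M"
  then show ?thesis using False by (auto simp: witness_def split: fm.splits)
qed

lemma decode_in_univ: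
  assumes "range p \<subseteq> univ M"
  shows "fst (decode M p \<phi>) \<in> univ M \<and> range (snd (decode M p \<phi>)) \<subseteq> univ M"
  using assms
  by (induction \<phi>) (auto simp: witness_in_univ image_subset_iff split: nat.splits)

definition hull :: "('u, 'f, 'r) fo_struct \<Rightarrow> (nat \<Rightarrow> 'u) \<Rightarrow> 'u set" where
  "hull M p = range (\<lambda>\<phi>. fst (decode M p \<phi>))"

lemma hull_subset: "range p \<subseteq> univ M \<Longrightarrow> hull M p \<subseteq> univ M"
  using decode_in_univ unfolding hull_def by fast

lemma generators_in_hull: "p n \<in> hull M p"
proof -
  have "p n = fst (decode M p (Equal (TVar n) (TVar n)))" by simp
  then show ?thesis unfolding hull_def by blast
qed

text \<open>The names of the first \<open>k\<close> values are strung together as \<open>k\<close>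
  list cells, the value at 0 being the head. Coding an initial segment is enough, since a formula
  has only finitely many free variables.\<close>

lemma decode_assignment:
  "(\<And>i. i < k \<Longrightarrow> e i \<in> hull M p) \<Longrightarrow> \<exists>\<psi>. \<forall>i<k. snd (decode M p \<psi>) i = e i"
proof (induction k arbitrary: e)
  case (Suc k)
  from Suc.IH[of "e \<circ> Suc"] Suc.prems obtain \<psi> where \<psi>: "\<forall>i<k. snd (decode M p \<psi>) i = e (Suc i)"
    by auto
  from Suc.prems[of 0] obtain \<phi> where "fst (decode M p \<phi>) = e 0" by (auto simp: hull_def)
  with \<psi> have "\<forall>i<Suc k. snd (decode M p (Conj \<phi> \<psi>)) i = e i" by (auto split: nat.splits)
  then show ?case by blast
qed simp

text \<open>This is the Tarski-Vaught criterion. The values of \<open>e\<close> at the free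
  variables of \<open>\<psi>\<close> are coded by some \<open>\<chi>\<close>, and then
  \<open>Conj (Exists i \<psi>) \<chi>\<close> names a witness.\<close>

lemma hull_Tarski_Vaught:
  assumes "\<And>i. e i \<in> hull M p" "b \<in> univ M" "sat M (e(i := b)) \<psi>"
  shows "\<exists>b \<in> hull M p. sat M (e(i := b)) \<psi>"
proof -
  obtain k where k: "fv \<psi> \<subseteq> {..<k}"
    using finite_nat_set_iff_bounded[THEN iffD1, OF finite_fv] by (metis lessThan_iff subsetI)
  obtain \<chi> where \<chi>: "\<forall>i<k. snd (decode M p \<chi>) i = e i"
    using decode_assignment[of k e M p] assms(1) by blast
  define e' where "e' = snd (decode M p \<chi>)"
  have eq: "sat M (e'(i := c)) \<psi> \<longleftrightarrow> sat M (e(i := c)) \<psi>" for c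
    using k \<chi> by (intro sat_cong) (auto simp: e'_def)
  with assms have "sat M e' (Exists i \<psi>)" by auto
  from witness_Exists[OF this] have "sat M (e(i := witness M e' (Exists i \<psi>))) \<psi>"
    by (simp add: eq)
  moreover have "witness M e' (Exists i \<psi>) = fst (decode M p (Conj (Exists i \<psi>) \<chi>))"
    by (simp add: e'_def)
  hence "witness M e' (Exists i \<psi>) \<in> hull M p" unfolding hull_def by blast
  ultimately show ?thesis by blast
qed

text \<open>The value of \<open>f\<close> at \<open>as\<close> is the only witness for an equation
  between a fresh variable and the term formed with \<open>f\<close>, so the Tarski-Vaught criterion
  puts it into the hull.\<close>

lemma hull_closed:
  assumes "is_struct L M" "range p \<subseteq> univ M" "(f, length as) \<in> fst L" "set as \<subseteq> hull M p"
  shows "fn_interp M f as \<in> hull M p"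
proof -
  define n where "n = length as"
  define e where "e i = (if i < n then as ! i else p 0)" for i
  have e: "e i \<in> hull M p" for i
    using assms(4) generators_in_hull by (auto simp: e_def n_def)
  have map: "map (e(n := b)) [0..<n] = as" for b
    by (rule nth_equalityI) (auto simp: e_def n_def)
  have "fn_interp M f as \<in> univ M"
    using assms hull_subset[OF assms(2)] by (auto simp: is_struct_def)
  moreover have vars: "map (eval_tm M (e(n := b)) \<circ> TVar) [0..<n] = as" for b
    unfolding map[of b, symmetric] by (intro map_cong) simp_all
  ultimately have "\<exists>b \<in> hull M p. sat M (e(n := b)) (Equal (TVar n) (TApp f (map TVar [0..<n])))"
    by (intro hull_Tarski_Vaught[OF e, of "fn_interp M f as"]) (simp_all del: map_eq_conv)
  then obtain b where b: "b \<in> hull M p" "sat M (e(n := b)) (Equal (TVar n) (TApp f (map TVar [0..<n])))"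
    by blast
  then show ?thesis using vars[of b] by (simp del: map_eq_conv)
qed

text \<open>The hull of the points \<open>p n\<close> is an elementary submodel by the Tarski-Vaught
  criterion. \<open>N\<close> is an isomorphic copy of it made of names, and \<open>g\<close> sends
  a name to the element named.\<close>

lemma downward_Loewenheim_Skolem:
  fixes M :: "('u, 'f, 'r) fo_struct" and p :: "nat \<Rightarrow> 'u"
  assumes "is_struct L M" "range p \<subseteq> univ M"
  obtains N :: "(('f, 'r) fm, 'f, 'r) fo_struct" and g
  where "is_struct L N" "inj_on g (univ N)" "g ` univ N \<subseteq> univ M" "range p \<subseteq> g ` univ N"
    "\<And>\<phi> e. wf_fm L \<phi> \<Longrightarrow> range e \<subseteq> univ N \<Longrightarrow> sat N e \<phi> \<longleftrightarrow> sat M (\<lambda>j. g (e j)) \<phi>"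
proof -
  define g where "g \<phi> = fst (decode M p \<phi>)" for \<phi> :: "('f, 'r) fm"
  define H where "H = hull M p"
  have H: "H = range g" by (simp add: H_def hull_def g_def)
  \<comment> \<open>An element may have many names; \<open>inv_into\<close> selects one for each,
    which makes \<open>g\<close> injective on the universe and lets equality be interpreted as
    identity.\<close>
  define N where "N = \<lparr>univ = inv_into UNIV g ` H, fn_interp = (\<lambda>f as. inv_into UNIV g (fn_interp M f (map g as))),
      rel_interp = (\<lambda>r as. rel_interp M r (map g as))\<rparr>"
  have g_inv: "g (inv_into UNIV g y) = y" if "y \<in> H" for y
    using that by (simp add: H f_inv_into_f)
  have image: "g ` univ N = H" by (force simp: N_def g_inv)
  have inj: "inj_on g (univ N)" by (auto simp: N_def g_inv inj_on_def)
  have closed: "fn_interp M f as \<in> H" if "(f, length as) \<in> fst L" "set as \<subseteq> H" for f as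
    using hull_closed[OF assms] that unfolding H_def by blast
  have eval: "eval_tm N e t \<in> univ N \<and> g (eval_tm N e t) = eval_tm M (\<lambda>j. g (e j)) t"
    if "wf_tm L t" "range e \<subseteq> univ N" for e t
    using that
  proof (induction t)
    case (TApp f ts)
    have IH: "eval_tm N e t \<in> univ N" "g (eval_tm N e t) = eval_tm M (\<lambda>j. g (e j)) t" if "t \<in> set ts" for t
      using TApp that by (auto simp: list_all_iff)
    have maps: "map (\<lambda>t. g (eval_tm N e t)) ts = map (eval_tm M (\<lambda>j. g (e j))) ts"
      using IH by (intro map_cong) auto
    have "set (map (eval_tm M (\<lambda>j. g (e j))) ts) \<subseteq> H"
      using IH image by (auto simp flip: IH(2))
    then have "fn_interp M f (map (eval_tm M (\<lambda>j. g (e j))) ts) \<in> H"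
      using TApp.prems by (intro closed) auto
    then show ?case
      by (simp add: N_def g_inv comp_def flip: maps)
  qed auto
  have sat: "sat N e \<phi> \<longleftrightarrow> sat M (\<lambda>j. g (e j)) \<phi>" if "wf_fm L \<phi>" "range e \<subseteq> univ N" for \<phi> e
    using that
  proof (induction \<phi> arbitrary: e)
    case (Equal s t)
    have "eval_tm N e s = eval_tm N e t \<longleftrightarrow> g (eval_tm N e s) = g (eval_tm N e t)"
      using Equal eval[of s e] eval[of t e] by (intro inj_on_eq_iff[OF inj, symmetric]) auto
    then show ?case using Equal eval[of s e] eval[of t e] by simp
  next
    case (Rel r ts)
    have "map (\<lambda>t. g (eval_tm N e t)) ts = map (eval_tm M (\<lambda>j. g (e j))) ts"
      using Rel eval by (intro map_cong) (auto simp: list_all_iff)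
    moreover have "rel_interp N r as = rel_interp M r (map g as)" for as by (simp add: N_def)
    ultimately show ?case by (simp add: comp_def del: map_eq_conv)
  next
    case (Exists i \<phi>)
    have upd: "(\<lambda>j. g ((e(i := b)) j)) = (\<lambda>j. g (e j))(i := g b)" for b by auto
    have in_H: "g (e j) \<in> H" for j using Exists.prems image by auto
    have "sat N e (Exists i \<phi>) \<longleftrightarrow> (\<exists>b \<in> univ N. sat M ((\<lambda>j. g (e j))(i := g b)) \<phi>)"
    proof -
      have "sat N (e(i := b)) \<phi> \<longleftrightarrow> sat M ((\<lambda>j. g (e j))(i := g b)) \<phi>" if "b \<in> univ N" for b
        using Exists.prems that unfolding upd[symmetric] by (intro Exists.IH) auto
      then show ?thesis by auto
    qed
    also have "\<dots> \<longleftrightarrow> (\<exists>b \<in> H. sat M ((\<lambda>j. g (e j))(i := b)) \<phi>)"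
      unfolding image[symmetric] by blast
    \<comment> \<open>The Tarski-Vaught criterion allows the quantifier to range over
      \<open>univ M\<close> instead of \<open>H\<close>.\<close>
    also have "\<dots> \<longleftrightarrow> (\<exists>b \<in> univ M. sat M ((\<lambda>j. g (e j))(i := b)) \<phi>)"
      using hull_Tarski_Vaught[of "\<lambda>j. g (e j)" M p] in_H hull_subset[OF assms(2)]
      unfolding H_def by blast
    finally show ?case by simp
  qed auto
  have struct: "is_struct L N"
  proof -
    have "univ N \<noteq> {}" using image generators_in_hull[of p 0 M] unfolding H_def by blast
    moreover have "fn_interp N f as \<in> univ N" if "(f, length as) \<in> fst L" "set as \<subseteq> univ N" for f as
    proof -
      have "fn_interp M f (map g as) \<in> H"
        using that image by (intro closed) auto
      then show ?thesis by (simp add: N_def)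
    qed
    ultimately show ?thesis by (auto simp: is_struct_def)
  qed
  show ?thesis
  proof (rule that[OF struct inj _ _ sat])
    show "g ` univ N \<subseteq> univ M" using image hull_subset[OF assms(2)] by (simp add: H_def)
    show "range p \<subseteq> g ` univ N" using image generators_in_hull[of p _ M] by (auto simp: H_def)
  qed
qed

section \<open>Definable families and inp-minimality\<close>

text \<open>One formula serves all \<open>j\<close> and only its parameters vary, as in a single row
  of an inp-pattern.\<close>

definition definable_family ::
    "('f, 'r) language \<Rightarrow> ('u, 'f, 'r) fo_struct \<Rightarrow> (nat \<Rightarrow> 'u set) \<Rightarrow> bool" where
  "definable_family L M X \<longleftrightarrow> (\<exists>\<phi> m a. partitioned_fm L 1 m \<phi> \<and>
     (\<forall>j. length (a j) = m \<and> set (a j) \<subseteq> univ M \<and>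
          X j = {x \<in> univ M. sat M ((!) (x # a j)) \<phi>}))"

text \<open>Otherwise the two families are the rows of a pattern of depth 2: disjointness makes each
  row 2-inconsistent, and the intersection points realise all paths. As patterns are sought only in
  models whose elements are formulas, the configuration is first moved to such a model by downward
  Loewenheim-Skolem.\<close>

lemma inp_minimal_definable_families:
  fixes M :: "('u, 'f, 'r) fo_struct"
  assumes M: "is_struct L M" and inp: "inp_minimal L (Th L M)"
    and "definable_family L M X" "disjoint_family X"
    and "definable_family L M Y" "disjoint_family Y"
  shows "\<exists>i j. X i \<inter> Y j = {}"
proof (rule ccontr)
  assume "\<not> ?thesis"
  then have "\<forall>i j. \<exists>x. x \<in> X i \<inter> Y j" by blast
  then obtain w where w: "\<And>i j. w i j \<in> X i \<inter> Y j" by metis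
  obtain \<phi>0 m0 a0 where X: "partitioned_fm L 1 m0 \<phi>0"
    "\<And>j. length (a0 j) = m0" "\<And>j. set (a0 j) \<subseteq> univ M"
    "\<And>j. X j = {x \<in> univ M. sat M ((!) (x # a0 j)) \<phi>0}"
    using assms(3) unfolding definable_family_def by blast
  obtain \<phi>1 m1 a1 where Y: "partitioned_fm L 1 m1 \<phi>1"
    "\<And>j. length (a1 j) = m1" "\<And>j. set (a1 j) \<subseteq> univ M"
    "\<And>j. Y j = {x \<in> univ M. sat M ((!) (x # a1 j)) \<phi>1}"
    using assms(5) unfolding definable_family_def by blast
  define \<phi> where "\<phi> r = (if r = 0 then \<phi>0 else \<phi>1)" for r :: nat
  define m where "m r = (if r = 0 then m0 else m1)" for r :: nat
  define a where "a r = (if r = 0 then a0 else a1)" for r :: nat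
  define Z where "Z r = (if r = 0 then X else Y)" for r :: nat
  have part: "partitioned_fm L 1 (m r) (\<phi> r)" for r
    using X(1) Y(1) by (simp add: m_def \<phi>_def)
  have a: "length (a r j) = m r" "set (a r j) \<subseteq> univ M" for r j
    using X(2,3) Y(2,3) by (auto simp: a_def m_def)
  have Z: "Z r j = {x \<in> univ M. sat M ((!) (x # a r j)) (\<phi> r)}" for r j
    using X(4) Y(4) by (simp add: a_def Z_def \<phi>_def)
  have disj: "disjoint_family (Z r)" for r using assms by (simp add: Z_def)
  have wZ: "w (\<eta> 0) (\<eta> 1) \<in> Z r (\<eta> r)" if "r < 2" for \<eta> r
    using w[of "\<eta> 0" "\<eta> 1"] that by (auto simp: Z_def less_2_cases_iff)
  have w_univ: "w i j \<in> univ M" for i j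
    using w[of i j] Z[of 0 i] by (auto simp: Z_def)
  \<comment> \<open>The points \<open>w i j\<close> are collected along with the parameters, because
    they must survive in the submodel to realise the paths there.\<close>
  define S where "S = (\<Union>r j. set (a r j)) \<union> range (\<lambda>(i, j). w i j)"
  have S: "S \<subseteq> univ M" "countable S" "S \<noteq> {}"
    using a(2) w_univ by (fastforce simp: S_def intro: countable_finite)+
  define p where "p = from_nat_into S"
  have range_p: "range p = S" using S by (simp add: p_def range_from_nat_into)
  obtain N :: "(('f, 'r) fm, 'f, 'r) fo_struct" and g where
    N: "is_struct L N" "inj_on g (univ N)" "g ` univ N \<subseteq> univ M" "S \<subseteq> g ` univ N" and
    elem: "\<And>\<phi> e. wf_fm L \<phi> \<Longrightarrow> range e \<subseteq> univ N \<Longrightarrow> sat N e \<phi> \<longleftrightarrow> sat M (\<lambda>j. g (e j)) \<phi>"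
    by (rule downward_Loewenheim_Skolem[of L M p]) (use M S range_p in auto)
  have models: "models L (Th L M) N"
    unfolding models_def true_in_def
  proof (intro conjI ballI allI impI)
    fix \<psi> and e :: "nat \<Rightarrow> ('f, 'r) fm" assume "\<psi> \<in> Th L M" "range e \<subseteq> univ N"
    moreover from this have "range (\<lambda>j. g (e j)) \<subseteq> univ M" using N(3) by auto
    ultimately show "sat N e \<psi>" by (auto simp: Th_def true_in_def elem)
  qed (rule N(1))
  define h where "h = inv_into (univ N) g"
  have h: "h x \<in> univ N" "g (h x) = x" if "x \<in> S" for x
    using that N(4) by (auto simp: h_def inv_into_into f_inv_into_f)
  have aS: "set (a r j) \<subseteq> S" for r j by (auto simp: S_def)
  have wS: "w i j \<in> S" for i j by (auto simp: S_def)
  define a' where "a' r j = map h (a r j)" for r j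
  have a': "length (a' r j) = m r" "set (a' r j) \<subseteq> univ N" "map g (a' r j) = a r j" for r j
    using a h aS[of r j] by (auto simp: a'_def intro!: map_idI)
  have sat_iff: "sat N ((!) (x # a' r j)) (\<phi> r) \<longleftrightarrow> g x \<in> Z r j" if "x \<in> univ N" for x r j
  proof -
    define l where "l = x # a' r j"
    \<comment> \<open>\<open>(!) l\<close> is unspecified beyond the length of \<open>l\<close>,
      whereas elementarity speaks of assignments into \<open>univ N\<close>; the padding with
      \<open>x\<close> bridges the gap.\<close>
    define e where "e i = (if i < length l then l ! i else x)" for i
    have l: "set l \<subseteq> univ N" "length l = 1 + m r" using that a' by (auto simp: l_def)
    have e: "range e \<subseteq> univ N" using l that by (auto simp: e_def)
    have fv: "wf_fm L (\<phi> r)" "fv (\<phi> r) \<subseteq> {..<1 + m r}"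
      using part[of r] by (auto simp: partitioned_fm_def)
    have "sat N ((!) l) (\<phi> r) \<longleftrightarrow> sat N e (\<phi> r)"
      using fv l by (intro sat_cong) (auto simp: e_def)
    also have "\<dots> \<longleftrightarrow> sat M (\<lambda>j. g (e j)) (\<phi> r)" using fv e by (intro elem)
    also have "\<dots> \<longleftrightarrow> sat M ((!) (map g l)) (\<phi> r)"
      using fv l by (intro sat_cong) (auto simp: e_def)
    also have "map g l = g x # a r j" by (simp add: l_def a')
    also have "sat M ((!) (g x # a r j)) (\<phi> r) \<longleftrightarrow> g x \<in> Z r j"
      using that N(3) by (auto simp: Z)
    finally show ?thesis by (simp add: l_def)
  qed
  have inconsistent: "k_inconsistent N 1 2 (\<phi> r) (a' r)" for r
    unfolding k_inconsistent_def
  proof (intro allI impI notI)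
    fix J :: "nat set" assume J: "finite J \<and> card J = 2"
      and cons: "consistent N 1 ((\<lambda>j. (\<phi> r, a' r j)) ` J)"
    from J obtain j j' where jj: "J = {j, j'}" "j \<noteq> j'" by (auto simp: card_2_iff)
    from cons J obtain b where b: "length b = 1" "set b \<subseteq> univ N"
      "\<forall>(\<psi>, c) \<in> (\<lambda>j. (\<phi> r, a' r j)) ` J. sat N ((!) (b @ c)) \<psi>"
      unfolding consistent_def by blast
    then obtain x where "b = [x]" by (auto simp: length_Suc_conv)
    with b jj sat_iff[of x r] have "g x \<in> Z r j \<inter> Z r j'" by auto
    then show False using disj[of r] jj by (auto simp: disjoint_family_on_def)
  qed
  have paths: "consistent N 1 ((\<lambda>\<psi>. (\<psi>, [])) ` {Equal (TVar 0) (TVar 0)} \<union>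
      (\<lambda>r. (\<phi> r, a' r (\<eta> r))) ` {..<2})" for \<eta> :: "nat \<Rightarrow> nat"
  proof -
    define x where "x = h (w (\<eta> 0) (\<eta> 1))"
    have "x \<in> univ N" "g x = w (\<eta> 0) (\<eta> 1)" using h[OF wS] by (auto simp: x_def)
    then have "sat N ((!) ([x] @ a' r (\<eta> r))) (\<phi> r)" if "r < 2" for r
      using that sat_iff[of x r "\<eta> r"] wZ by auto
    then show ?thesis unfolding consistent_def using \<open>x \<in> univ N\<close>
      by (intro allI impI exI[of _ "[x]"]) auto
  qed
  have "inp_pattern L (Th L M) 1 {Equal (TVar 0) (TVar 0)} {..<2} N \<phi> m a'"
    unfolding inp_pattern_def using models part a' inconsistent paths by blast
  then have "has_inp_pattern L (Th L M) 1 {Equal (TVar 0) (TVar 0)} {..<2}"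
    unfolding has_inp_pattern_def by blast
  then show False using inp unfolding inp_minimal_def inp_rank_eq_def by fastforce
qed

section \<open>Definability of translated centralizers and of half-open intervals\<close>

text \<open>The parameters \<open>c\<close> are fixed before the variables \<open>vs\<close> and the
  block starting at \<open>d\<close>. Hence several instances of one definable relation, in
  different variables, can share a block of parameters inside a larger formula.\<close>

lemma definable_instance:
  assumes "definable L M n X"
  shows "\<exists>c. set c \<subseteq> univ M \<and>
    (\<forall>vs d. length vs = n \<longrightarrow> distinct vs \<longrightarrow> set vs \<inter> {d..<d + length c} = {} \<longrightarrow>
      (\<exists>\<psi>. wf_fm L \<psi> \<and> fv \<psi> \<subseteq> set vs \<union> {d..<d + length c} \<and>
        (\<forall>e. range e \<subseteq> univ M \<longrightarrow> (\<forall>k<length c. e (d + k) = c ! k) \<longrightarrow>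
          (sat M e \<psi> \<longleftrightarrow> map e vs \<in> X))))"
proof -
  obtain \<phi> c where \<phi>: "wf_fm L \<phi>" "fv \<phi> \<subseteq> {..<n + length c}" and c: "set c \<subseteq> univ M"
    and X: "X = {b. length b = n \<and> set b \<subseteq> univ M \<and> sat M ((!) (b @ c)) \<phi>}"
    using assms unfolding definable_def partitioned_fm_def by blast
  show ?thesis
  proof (intro exI[of _ c] conjI c allI impI)
    fix vs :: "nat list" and d
    assume vs: "length vs = n" "distinct vs" "set vs \<inter> {d..<d + length c} = {}"
    define f where "f i = (vs @ [d..<d + length c]) ! i" for i
    have "distinct (vs @ [d..<d + length c])" using vs by simp
    then have inj: "inj_on f {..<n + length c}"
      using vs(1) by (auto simp: f_def inj_on_def nth_eq_iff_index_eq)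
    have f_image: "f ` {..<n + length c} \<subseteq> set vs \<union> {d..<d + length c}"
      using vs(1) by (auto simp: f_def nth_append)
    obtain \<psi> where \<psi>: "wf_fm L \<psi>" "fv \<psi> = f ` fv \<phi>"
      "\<And>e. sat M e \<psi> \<longleftrightarrow> sat M (\<lambda>i. e (f i)) \<phi>"
      using exists_renaming[OF \<phi> inj] by metis
    have "sat M e \<psi> \<longleftrightarrow> map e vs \<in> X"
      if e: "range e \<subseteq> univ M" "\<forall>k<length c. e (d + k) = c ! k" for e
    proof -
      have "sat M (\<lambda>i. e (f i)) \<phi> \<longleftrightarrow> sat M ((!) (map e vs @ c)) \<phi>"
      proof (intro sat_cong)
        fix i assume "i \<in> fv \<phi>"
        then have "i < n + length c" using \<phi>(2) by auto
        then show "e (f i) = (map e vs @ c) ! i"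
          using vs(1) e(2)[rule_format, of "i - n"] by (auto simp: f_def nth_append)
      qed
      then show ?thesis using \<psi>(3) vs(1) e(1) by (auto simp: X)
    qed
    then show "\<exists>\<psi>. wf_fm L \<psi> \<and> fv \<psi> \<subseteq> set vs \<union> {d..<d + length c} \<and>
        (\<forall>e. range e \<subseteq> univ M \<longrightarrow> (\<forall>k<length c. e (d + k) = c ! k) \<longrightarrow>
          (sat M e \<psi> \<longleftrightarrow> map e vs \<in> X))"
      using \<psi>(1,2) f_image \<phi>(2) by (intro exI[of _ \<psi>]) blast
  qed
qed

text \<open>The condition \<open>sat\<close> concerns only total assignments into the universe,
  which spares later constructions the unspecified tail of \<open>(!)\<close>.\<close>

lemma definable_familyI:
  assumes "wf_fm L \<phi>" "fv \<phi> \<subseteq> {..<Suc m}"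
    and a: "\<And>j. length (a j) = m" "\<And>j. set (a j) \<subseteq> univ M"
    and X: "\<And>j. X j \<subseteq> univ M"
    and sat: "\<And>j e. range e \<subseteq> univ M \<Longrightarrow> (\<And>k. k < m \<Longrightarrow> e (Suc k) = a j ! k) \<Longrightarrow>
      sat M e \<phi> \<longleftrightarrow> e 0 \<in> X j"
  shows "definable_family L M X"
proof -
  have "sat M ((!) (x # a j)) \<phi> \<longleftrightarrow> x \<in> X j" if x: "x \<in> univ M" for x j
  proof -
    define e where "e i = (if i < Suc m then (x # a j) ! i else x)" for i
    have "set (x # a j) \<subseteq> univ M" using x a by simp
    then have "(x # a j) ! i \<in> univ M" if "i < Suc m" for i
      by (rule subsetD[OF _ nth_mem]) (simp add: a that)
    then have e: "range e \<subseteq> univ M" using x by (simp add: e_def image_subset_iff)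
    have "sat M ((!) (x # a j)) \<phi> \<longleftrightarrow> sat M e \<phi>"
      using assms(2) by (intro sat_cong) (auto simp: e_def)
    also have "\<dots> \<longleftrightarrow> e 0 \<in> X j" using e by (intro sat) (auto simp: e_def)
    finally show ?thesis by (simp add: e_def)
  qed
  then have "X j = {x \<in> univ M. sat M ((!) (x # a j)) \<phi>}" for j using X by auto
  then show ?thesis
    unfolding definable_family_def partitioned_fm_def using assms(1,2) a
    by (intro exI[of _ \<phi>] exI[of _ m] exI[of _ a]) simp
qed

text \<open>Two translating factors \<open>p j\<close> and \<open>q j\<close> cover left and right
  cosets of a centralizer at once. Variable 0 is the object, 1 to 3 hold \<open>p j\<close>,
  \<open>q j\<close> and \<open>b\<close>, and the parameters of the multiplication start at
  4.\<close>

lemma definable_family_commuting: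
  fixes G :: "'a monoid"
  assumes "group G" and carrier: "carrier G = univ M"
    and "definable L M 3 {[x, y, x \<otimes>\<^bsub>G\<^esub> y] | x y. x \<in> univ M \<and> y \<in> univ M}"
    and p: "\<And>j. p j \<in> carrier G" and q: "\<And>j. q j \<in> carrier G" and b: "b \<in> carrier G"
  shows "definable_family L M
    (\<lambda>j. {x \<in> carrier G. (p j \<otimes>\<^bsub>G\<^esub> x \<otimes>\<^bsub>G\<^esub> q j) \<otimes>\<^bsub>G\<^esub> b = b \<otimes>\<^bsub>G\<^esub> (p j \<otimes>\<^bsub>G\<^esub> x \<otimes>\<^bsub>G\<^esub> q j)})"
proof -
  interpret group G by fact
  let ?X = "{[x, y, x \<otimes>\<^bsub>G\<^esub> y] | x y. x \<in> univ M \<and> y \<in> univ M}"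
  obtain c where c: "set c \<subseteq> univ M" and inst:
    "\<forall>vs d. length vs = 3 \<longrightarrow> distinct vs \<longrightarrow> set vs \<inter> {d..<d + length c} = {} \<longrightarrow>
      (\<exists>\<psi>. wf_fm L \<psi> \<and> fv \<psi> \<subseteq> set vs \<union> {d..<d + length c} \<and>
        (\<forall>e. range e \<subseteq> univ M \<longrightarrow> (\<forall>k<length c. e (d + k) = c ! k) \<longrightarrow>
          (sat M e \<psi> \<longleftrightarrow> map e vs \<in> ?X)))"
    using definable_instance[OF assms(3)] by (elim exE conjE) 
  define m where "m = length c"
  \<comment> \<open>Multiplication is available only through its graph, so the intermediate products
    need variables of their own, placed above the parameter block and quantified away in
    \<open>\<phi>\<close>.\<close>
  define t where "t = 4 + m"
  define u where "u = 5 + m"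
  define v where "v = 6 + m"
  have inst': "\<exists>\<psi>. wf_fm L \<psi> \<and> fv \<psi> \<subseteq> {i, j, k} \<union> {4..<4 + m} \<and>
        (\<forall>e. range e \<subseteq> univ M \<longrightarrow> (\<forall>k<m. e (4 + k) = c ! k) \<longrightarrow>
          (sat M e \<psi> \<longleftrightarrow> e k = e i \<otimes>\<^bsub>G\<^esub> e j))"
    if "distinct [i, j, k]" "{i, j, k} \<inter> {4..<4 + m} = {}" for i j k
  proof -
    have "distinct [i, j, k]" "set [i, j, k] \<inter> {4..<4 + length c} = {}"
      using that by (simp_all add: m_def)
    moreover have "length [i, j, k] = 3" by simp
    ultimately obtain \<psi> where
      "wf_fm L \<psi> \<and> fv \<psi> \<subseteq> set [i, j, k] \<union> {4..<4 + m} \<and>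
        (\<forall>e. range e \<subseteq> univ M \<longrightarrow> (\<forall>k<m. e (4 + k) = c ! k) \<longrightarrow>
          (sat M e \<psi> \<longleftrightarrow> map e [i, j, k] \<in> ?X))"
      using inst unfolding m_def by meson
    moreover have "map e [i, j, k] \<in> ?X \<longleftrightarrow> e k = e i \<otimes>\<^bsub>G\<^esub> e j" if "range e \<subseteq> univ M" for e
    proof -
      have "e i \<in> univ M" "e j \<in> univ M" using that by blast+
      then show ?thesis by simp
    qed
    ultimately show ?thesis by (intro exI[of _ \<psi>]) (simp del: list.map)
  qed
  \<comment> \<open>With \<open>x\<close> the object, the four instances express
    \<open>t = p x\<close>, \<open>u = t q\<close>, \<open>v = u b\<close> and
    \<open>v = b u\<close>; the last two together say that \<open>u\<close> commutes with
    \<open>b\<close>.\<close>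
  have d1: "distinct [1, 0, t]" "{1, 0, t} \<inter> {4..<4 + m} = {}"
    by (auto simp: t_def u_def v_def)
  obtain \<psi>1 where \<psi>1: "wf_fm L \<psi>1" "fv \<psi>1 \<subseteq> {1, 0, t} \<union> {4..<4 + m}"
    "\<And>e. range e \<subseteq> univ M \<Longrightarrow> (\<forall>k<m. e (4 + k) = c ! k) \<Longrightarrow> sat M e \<psi>1 \<longleftrightarrow> e t = e 1 \<otimes>\<^bsub>G\<^esub> e 0"
    using inst'[OF d1] by blast
  have d2: "distinct [t, 2, u]" "{t, 2, u} \<inter> {4..<4 + m} = {}"
    by (auto simp: t_def u_def v_def)
  obtain \<psi>2 where \<psi>2: "wf_fm L \<psi>2" "fv \<psi>2 \<subseteq> {t, 2, u} \<union> {4..<4 + m}"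
    "\<And>e. range e \<subseteq> univ M \<Longrightarrow> (\<forall>k<m. e (4 + k) = c ! k) \<Longrightarrow> sat M e \<psi>2 \<longleftrightarrow> e u = e t \<otimes>\<^bsub>G\<^esub> e 2"
    using inst'[OF d2] by blast
  have d3: "distinct [u, 3, v]" "{u, 3, v} \<inter> {4..<4 + m} = {}"
    by (auto simp: t_def u_def v_def)
  obtain \<psi>3 where \<psi>3: "wf_fm L \<psi>3" "fv \<psi>3 \<subseteq> {u, 3, v} \<union> {4..<4 + m}"
    "\<And>e. range e \<subseteq> univ M \<Longrightarrow> (\<forall>k<m. e (4 + k) = c ! k) \<Longrightarrow> sat M e \<psi>3 \<longleftrightarrow> e v = e u \<otimes>\<^bsub>G\<^esub> e 3"
    using inst'[OF d3] by blast
  have d4: "distinct [3, u, v]" "{3, u, v} \<inter> {4..<4 + m} = {}"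
    by (auto simp: t_def u_def v_def)
  obtain \<psi>4 where \<psi>4: "wf_fm L \<psi>4" "fv \<psi>4 \<subseteq> {3, u, v} \<union> {4..<4 + m}"
    "\<And>e. range e \<subseteq> univ M \<Longrightarrow> (\<forall>k<m. e (4 + k) = c ! k) \<Longrightarrow> sat M e \<psi>4 \<longleftrightarrow> e v = e 3 \<otimes>\<^bsub>G\<^esub> e u"
    using inst'[OF d4] by blast
  define \<phi> where "\<phi> = Exists t (Exists u (Exists v (Conj (Conj \<psi>1 \<psi>2) (Conj \<psi>3 \<psi>4))))"
  show ?thesis
  proof (rule definable_familyI[where \<phi> = \<phi> and m = "3 + m" and a = "\<lambda>j. [p j, q j, b] @ c"])
    show "wf_fm L \<phi>" using \<psi>1 \<psi>2 \<psi>3 \<psi>4 by (simp add: \<phi>_def)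
    show "fv \<phi> \<subseteq> {..<Suc (3 + m)}"
      using \<psi>1(2) \<psi>2(2) \<psi>3(2) \<psi>4(2) by (fastforce simp: \<phi>_def)
  next
    fix j and e :: "nat \<Rightarrow> 'a"
    assume e: "range e \<subseteq> univ M" and "\<And>k. k < 3 + m \<Longrightarrow> e (Suc k) = ([p j, q j, b] @ c) ! k"
    note this(2)[of 0] this(2)[of 1] this(2)[of 2] this(2)[of "3 + _"]
    then have eq: "e 1 = p j" "e 2 = q j" "e 3 = b" "\<And>k. k < m \<Longrightarrow> e (4 + k) = c ! k"
      by (simp_all add: numeral_eq_Suc)
    have step: "sat M (e(t := t', u := u', v := v')) (Conj (Conj \<psi>1 \<psi>2) (Conj \<psi>3 \<psi>4)) \<longleftrightarrow>
        t' = p j \<otimes>\<^bsub>G\<^esub> e 0 \<and> u' = t' \<otimes>\<^bsub>G\<^esub> q j \<and> v' = u' \<otimes>\<^bsub>G\<^esub> b \<and> v' = b \<otimes>\<^bsub>G\<^esub> u'"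
      if "t' \<in> univ M" "u' \<in> univ M" "v' \<in> univ M" for t' u' v'
    proof -
      define e' where "e' = e(t := t', u := u', v := v')"
      have e': "range e' \<subseteq> univ M" "\<forall>k<m. e' (4 + k) = c ! k"
        using e that eq by (auto simp: e'_def t_def u_def v_def)
      have vals: "e' 0 = e 0" "e' 1 = p j" "e' 2 = q j" "e' 3 = b" "e' t = t'" "e' u = u'" "e' v = v'"
        using eq by (auto simp: e'_def t_def u_def v_def)
      show ?thesis
        unfolding e'_def[symmetric] sat.simps \<psi>1(3)[OF e'] \<psi>2(3)[OF e'] \<psi>3(3)[OF e'] \<psi>4(3)[OF e'] vals
        by auto
    qed
    define y where "y = p j \<otimes>\<^bsub>G\<^esub> e 0 \<otimes>\<^bsub>G\<^esub> q j"
    have "e 0 \<in> carrier G" using e carrier by auto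
    then have closed: "p j \<otimes>\<^bsub>G\<^esub> e 0 \<in> univ M" "y \<in> univ M" "y \<otimes>\<^bsub>G\<^esub> b \<in> univ M"
      using p q b unfolding carrier[symmetric] y_def by simp_all
    have "sat M e \<phi> \<longleftrightarrow> (\<exists>t' \<in> univ M. \<exists>u' \<in> univ M. \<exists>v' \<in> univ M.
        t' = p j \<otimes>\<^bsub>G\<^esub> e 0 \<and> u' = t' \<otimes>\<^bsub>G\<^esub> q j \<and> v' = u' \<otimes>\<^bsub>G\<^esub> b \<and> v' = b \<otimes>\<^bsub>G\<^esub> u')"
      unfolding \<phi>_def sat.simps(5) by (intro bex_cong refl step)
    also have "\<dots> \<longleftrightarrow> y \<otimes>\<^bsub>G\<^esub> b = b \<otimes>\<^bsub>G\<^esub> y"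
    proof
      assume "y \<otimes>\<^bsub>G\<^esub> b = b \<otimes>\<^bsub>G\<^esub> y"
      then show "\<exists>t' \<in> univ M. \<exists>u' \<in> univ M. \<exists>v' \<in> univ M.
        t' = p j \<otimes>\<^bsub>G\<^esub> e 0 \<and> u' = t' \<otimes>\<^bsub>G\<^esub> q j \<and> v' = u' \<otimes>\<^bsub>G\<^esub> b \<and> v' = b \<otimes>\<^bsub>G\<^esub> u'"
        by (intro bexI[OF _ closed(1)] bexI[OF _ closed(2)] bexI[OF _ closed(3)]) (simp add: y_def)
    qed (auto simp: y_def)
    finally show "sat M e \<phi> \<longleftrightarrow> e 0 \<in> {x \<in> carrier G.
        (p j \<otimes>\<^bsub>G\<^esub> x \<otimes>\<^bsub>G\<^esub> q j) \<otimes>\<^bsub>G\<^esub> b = b \<otimes>\<^bsub>G\<^esub> (p j \<otimes>\<^bsub>G\<^esub> x \<otimes>\<^bsub>G\<^esub> q j)}"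
      using \<open>e 0 \<in> carrier G\<close> by (simp add: y_def)
  qed (use p q b c carrier in \<open>auto simp: m_def\<close>)
qed

text \<open>Variable 0 is the object, 1 and 2 hold the endpoints, and the parameters of the ordering
  start at 3.\<close>

lemma definable_family_half_open_interval:
  fixes M :: "('a, 'f, 'r) fo_struct"
  assumes "definable L M 2 {[x, y] | x y. x \<in> univ M \<and> y \<in> univ M \<and> lt x y}"
    and s: "\<And>j. s j \<in> univ M" and t: "\<And>j. t j \<in> univ M"
  shows "definable_family L M (\<lambda>j. {x \<in> univ M. \<not> lt x (s j) \<and> lt x (t j)})"
proof -
  let ?X = "{[x, y] | x y. x \<in> univ M \<and> y \<in> univ M \<and> lt x y}"
  obtain c where c: "set c \<subseteq> univ M" and inst:
    "\<forall>vs d. length vs = 2 \<longrightarrow> distinct vs \<longrightarrow> set vs \<inter> {d..<d + length c} = {} \<longrightarrow>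
      (\<exists>\<psi>. wf_fm L \<psi> \<and> fv \<psi> \<subseteq> set vs \<union> {d..<d + length c} \<and>
        (\<forall>e. range e \<subseteq> univ M \<longrightarrow> (\<forall>k<length c. e (d + k) = c ! k) \<longrightarrow>
          (sat M e \<psi> \<longleftrightarrow> map e vs \<in> ?X)))"
    using definable_instance[OF assms(1)] by (elim exE conjE) 
  have inst': "\<exists>\<psi>. wf_fm L \<psi> \<and> fv \<psi> \<subseteq> {i, j} \<union> {3..<3 + length c} \<and>
        (\<forall>e. range e \<subseteq> univ M \<longrightarrow> (\<forall>k<length c. e (3 + k) = c ! k) \<longrightarrow>
          (sat M e \<psi> \<longleftrightarrow> lt (e i) (e j)))"
    if "i \<noteq> j" "i < 3" "j < 3" for i j
  proof -
    have "distinct [i, j]" "set [i, j] \<inter> {3..<3 + length c} = {}" "length [i, j] = 2" using that by auto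
    with inst obtain \<psi> where
      "wf_fm L \<psi> \<and> fv \<psi> \<subseteq> set [i, j] \<union> {3..<3 + length c} \<and>
        (\<forall>e. range e \<subseteq> univ M \<longrightarrow> (\<forall>k<length c. e (3 + k) = c ! k) \<longrightarrow>
          (sat M e \<psi> \<longleftrightarrow> map e [i, j] \<in> ?X))"
      by meson
    moreover have "map e [i, j] \<in> ?X \<longleftrightarrow> lt (e i) (e j)" if "range e \<subseteq> univ M" for e
      using that by auto
    ultimately show ?thesis by (intro exI[of _ \<psi>]) (simp del: list.map)
  qed
  have d1: "(0 :: nat) \<noteq> 1" "(0 :: nat) < 3" "(1 :: nat) < 3" by auto
  obtain \<psi>1 where \<psi>1: "wf_fm L \<psi>1" "fv \<psi>1 \<subseteq> {0, 1} \<union> {3..<3 + length c}"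
    "\<And>e. range e \<subseteq> univ M \<Longrightarrow> (\<forall>k<length c. e (3 + k) = c ! k) \<Longrightarrow> sat M e \<psi>1 \<longleftrightarrow> lt (e 0) (e 1)"
    using inst'[OF d1] by blast
  have d2: "(0 :: nat) \<noteq> 2" "(0 :: nat) < 3" "(2 :: nat) < 3" by auto
  obtain \<psi>2 where \<psi>2: "wf_fm L \<psi>2" "fv \<psi>2 \<subseteq> {0, 2} \<union> {3..<3 + length c}"
    "\<And>e. range e \<subseteq> univ M \<Longrightarrow> (\<forall>k<length c. e (3 + k) = c ! k) \<Longrightarrow> sat M e \<psi>2 \<longleftrightarrow> lt (e 0) (e 2)"
    using inst'[OF d2] by blast
  show ?thesis
  proof (rule definable_familyI[where \<phi> = "Conj (Neg \<psi>1) \<psi>2" and m = "2 + length c"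
        and a = "\<lambda>j. [s j, t j] @ c"])
    show "wf_fm L (Conj (Neg \<psi>1) \<psi>2)" using \<psi>1 \<psi>2 by simp
    show "fv (Conj (Neg \<psi>1) \<psi>2) \<subseteq> {..<Suc (2 + length c)}"
      using \<psi>1(2) \<psi>2(2) by fastforce
    show "length ([s j, t j] @ c) = 2 + length c" for j by simp
    show "set ([s j, t j] @ c) \<subseteq> univ M" for j using s t c by simp
    show "{x \<in> univ M. \<not> lt x (s j) \<and> lt x (t j)} \<subseteq> univ M" for j by blast
  next
    fix j and e :: "nat \<Rightarrow> 'a"
    assume e: "range e \<subseteq> univ M"
      and "\<And>k. k < 2 + length c \<Longrightarrow> e (Suc k) = ([s j, t j] @ c) ! k"
    note this(2)[of 0] this(2)[of 1] this(2)[of "2 + _"]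
    then have "e 1 = s j" "e 2 = t j" "\<forall>k<length c. e (3 + k) = c ! k"
      by (simp_all add: numeral_eq_Suc)
    then show "sat M e (Conj (Neg \<psi>1) \<psi>2) \<longleftrightarrow> e 0 \<in> {x \<in> univ M. \<not> lt x (s j) \<and> lt x (t j)}"
      using e \<psi>1(3) \<psi>2(3) by auto
  qed
qed

section \<open>Left-ordered groups\<close>

locale left_ordered_group = group G for G (structure) +
  fixes lt :: "'a \<Rightarrow> 'a \<Rightarrow> bool"
  assumes left_ordering: "left_ordering G lt"
begin

lemma lt_irrefl: "x \<in> carrier G \<Longrightarrow> \<not> lt x x"
  using left_ordering by (simp add: left_ordering_def irreflp_on_def)

lemma lt_trans: "lt x y \<Longrightarrow> lt y z \<Longrightarrow> x \<in> carrier G \<Longrightarrow> y \<in> carrier G \<Longrightarrow> z \<in> carrier G \<Longrightarrow> lt x z"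
  using left_ordering unfolding left_ordering_def transp_on_def by blast

lemma lt_total: "x \<in> carrier G \<Longrightarrow> y \<in> carrier G \<Longrightarrow> x \<noteq> y \<Longrightarrow> lt x y \<or> lt y x"
  using left_ordering unfolding left_ordering_def totalp_on_def by blast

lemma mult_left_mono:
  "lt x y \<Longrightarrow> g \<in> carrier G \<Longrightarrow> x \<in> carrier G \<Longrightarrow> y \<in> carrier G \<Longrightarrow> lt (g \<otimes> x) (g \<otimes> y)"
  using left_ordering unfolding left_ordering_def by blast

lemma lt_mult_left_iff:
  assumes [simp]: "g \<in> carrier G" "x \<in> carrier G" "y \<in> carrier G"
  shows "lt (g \<otimes> x) (g \<otimes> y) \<longleftrightarrow> lt x y"
  using mult_left_mono[of x y g] mult_left_mono[of "g \<otimes> x" "g \<otimes> y" "inv g"]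
  by (auto simp: m_assoc[symmetric])

lemma pos_mult:
  assumes "lt \<one> x" "lt \<one> y" "x \<in> carrier G" "y \<in> carrier G"
  shows "lt \<one> (x \<otimes> y)"
  using lt_trans[of \<one> x "x \<otimes> y"] mult_left_mono[of \<one> y x] assms by simp

lemma pos_pow: "n > 0 \<Longrightarrow> lt \<one> x \<Longrightarrow> x \<in> carrier G \<Longrightarrow> lt \<one> (x [^] (n :: nat))"
  by (induction n rule: nat_induct_non_zero) (auto intro: pos_mult)

lemma pos_inv_iff: "x \<in> carrier G \<Longrightarrow> lt \<one> (inv x) \<longleftrightarrow> lt x \<one>"
  using lt_mult_left_iff[of x \<one> "inv x"] by simp

text \<open>If \<open>x\<close> is neither positive nor trivial, then its inverse is positive, and
  so are the positive powers of the inverse.\<close>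

lemma pos_pow_iff:
  assumes "x \<in> carrier G" "n > 0"
  shows "lt \<one> (x [^] (n :: nat)) \<longleftrightarrow> lt \<one> x"
proof
  assume pos: "lt \<one> (x [^] n)"
  show "lt \<one> x"
  proof (rule ccontr)
    assume "\<not> lt \<one> x"
    moreover have "x \<noteq> \<one>" using pos lt_irrefl by auto
    ultimately have "lt \<one> (inv x)" using assms lt_total[of \<one> x] by (auto simp: pos_inv_iff)
    then have "lt \<one> (inv (x [^] n))" using pos_pow[of n "inv x"] assms by (simp add: nat_pow_inv)
    then have "lt (x [^] n) \<one>" using assms by (simp add: pos_inv_iff)
    then show False using pos lt_trans[of \<one> "x [^] n" \<one>] lt_irrefl assms by auto
  qed
qed (use assms pos_pow in auto)

lemma conj_pow:
  assumes [simp]: "x \<in> carrier G" "y \<in> carrier G"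
  shows "(inv y \<otimes> x \<otimes> y) [^] (n :: nat) = inv y \<otimes> x [^] n \<otimes> y"
proof (induction n)
  case (Suc n)
  have "y \<otimes> (inv y \<otimes> (x \<otimes> y)) = x \<otimes> y" by (simp flip: m_assoc)
  then show ?case using Suc by (simp add: m_assoc)
qed simp

text \<open>In a left-ordered group conjugation may destroy positivity. Here \<open>x\<close> and
  its conjugate have the same \<open>n\<close>-th power, and the sign of that power decides the sign
  of both.\<close>

lemma pos_conj:
  assumes [simp]: "x \<in> carrier G" "y \<in> carrier G"
    and "n > 0" "x [^] (n :: nat) \<otimes> y = y \<otimes> x [^] n" "lt \<one> x"
  shows "lt \<one> (inv y \<otimes> x \<otimes> y)"
proof -
  have "(inv y \<otimes> x \<otimes> y) [^] n = x [^] n"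
    unfolding conj_pow[OF assms(1,2)] by (simp add: m_assoc assms(4)) (simp flip: m_assoc)
  then show ?thesis
    using assms pos_pow_iff[of "inv y \<otimes> x \<otimes> y" n] pos_pow_iff[of x n] by simp
qed

lemma int_pow_strict_mono:
  assumes "lt \<one> z" "z \<in> carrier G" "i < (j :: int)"
  shows "lt (z [^] i) (z [^] j)"
proof -
  have "lt \<one> (z [^] nat (j - i))" using assms by (intro pos_pow) auto
  then have "lt \<one> (z [^] (j - i))" using assms(3) by (simp add: int_pow_def nat_pow_def split: if_splits)
  then have "lt (z [^] i \<otimes> \<one>) (z [^] i \<otimes> z [^] (j - i))"
    using assms by (intro mult_left_mono) auto
  then show ?thesis using assms by (simp add: int_pow_mult[symmetric])
qed

section \<open>Centralizers and the convex hull of the powers of an element\<close>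

definition centralizer :: "'a \<Rightarrow> 'a set" where
  "centralizer z = {x \<in> carrier G. x \<otimes> z = z \<otimes> x}"

lemma centralizer_subgroup:
  assumes [simp]: "z \<in> carrier G"
  shows "subgroup (centralizer z) G"
proof
  fix x y assume "x \<in> centralizer z" "y \<in> centralizer z"
  then have [simp]: "x \<in> carrier G" "y \<in> carrier G" and "x \<otimes> z = z \<otimes> x" "y \<otimes> z = z \<otimes> y"
    by (auto simp: centralizer_def)
  then have "x \<otimes> y \<otimes> z = z \<otimes> (x \<otimes> y)" by (metis assms m_assoc)
  then show "x \<otimes> y \<in> centralizer z" by (simp add: centralizer_def)
next
  fix x assume "x \<in> centralizer z"
  then have [simp]: "x \<in> carrier G" and "x \<otimes> z = z \<otimes> x" by (auto simp: centralizer_def)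
  then have "inv x \<otimes> z = z \<otimes> inv x"
    by (metis assms inv_closed inv_solve_left inv_solve_right m_assoc m_closed)
  then show "inv x \<in> centralizer z" by (simp add: centralizer_def)
qed (auto simp: centralizer_def)

lemma centralizer_sym: "x \<in> centralizer y \<Longrightarrow> y \<in> carrier G \<Longrightarrow> y \<in> centralizer x"
  by (simp add: centralizer_def)

lemma centralizer_int_pow:
  assumes "x \<in> centralizer z" "z \<in> carrier G"
  shows "x [^] (i :: int) \<in> centralizer z"
  using assms by (intro subgroup_int_pow_closed centralizer_subgroup)

definition local_hull :: "'a \<Rightarrow> 'a set" where
  "local_hull z = {x \<in> centralizer z. \<exists>(i :: int) (j :: int). lt (z [^] i) x \<and> lt x (z [^] j)}"

text \<open>The order is invariant only on the left. Commuting with the powers of \<open>z\<close>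
  makes up for that: bounds on \<open>x\<close> may be multiplied by such a power on either
  side.\<close>

lemma local_hull_subgroup:
  assumes z: "z \<in> carrier G" "lt \<one> z"
  shows "subgroup (local_hull z) G"
proof -
  interpret C: subgroup "centralizer z" G using centralizer_subgroup z by simp
  have comm: "x \<otimes> z [^] i = z [^] i \<otimes> x" if "x \<in> centralizer z" for x and i :: int
  proof -
    have "z [^] i \<in> centralizer x"
      by (rule centralizer_int_pow[OF centralizer_sym[OF that z(1)] C.mem_carrier[OF that]])
    then have "z [^] i \<otimes> x = x \<otimes> z [^] i" unfolding centralizer_def by blast
    then show ?thesis by (rule sym)
  qed
  show ?thesis
  proof (rule subgroup.intro)
    show "local_hull z \<subseteq> carrier G" by (auto simp: local_hull_def)
    have "lt (z [^] (-1 :: int)) (z [^] (0 :: int))" "lt (z [^] (0 :: int)) (z [^] (1 :: int))"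
      using z by (auto intro!: int_pow_strict_mono simp del: int_pow_0 int_pow_1)
    then show "\<one> \<in> local_hull z" unfolding local_hull_def
      by (simp del: int_pow_1) blast
  next
    fix x y assume "x \<in> local_hull z" "y \<in> local_hull z"
    then obtain i j k l :: int where x: "x \<in> centralizer z" "lt (z [^] i) x" "lt x (z [^] j)"
      and y: "y \<in> centralizer z" "lt (z [^] k) y" "lt y (z [^] l)"
      by (auto simp: local_hull_def)
    have [simp]: "x \<in> carrier G" "y \<in> carrier G" using x y by auto
    \<comment> \<open>The products are compared through \<open>x \<otimes> z [^] k\<close> from
      below and \<open>x \<otimes> z [^] l\<close> from above: one factor is replaced by its bound
      at a time.\<close>
    have "lt (z [^] (k + i)) (x \<otimes> z [^] k)"
      using mult_left_mono[OF x(2), of "z [^] k"] z comm[OF x(1)] by (simp add: int_pow_mult)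
    moreover have "lt (x \<otimes> z [^] k) (x \<otimes> y)"
      using z y(2) by (intro mult_left_mono) auto
    ultimately have "lt (z [^] (k + i)) (x \<otimes> y)" using z lt_trans by (meson \<open>x \<in> carrier G\<close> \<open>y \<in> carrier G\<close> int_pow_closed m_closed)
    moreover have "lt (x \<otimes> z [^] l) (z [^] (l + j))"
      using mult_left_mono[OF x(3), of "z [^] l"] z comm[OF x(1)] by (simp add: int_pow_mult)
    moreover have "lt (x \<otimes> y) (x \<otimes> z [^] l)"
      using z y(3) by (intro mult_left_mono) auto
    ultimately have "lt (z [^] (k + i)) (x \<otimes> y) \<and> lt (x \<otimes> y) (z [^] (l + j))"
      using z lt_trans by (meson \<open>x \<in> carrier G\<close> \<open>y \<in> carrier G\<close> int_pow_closed m_closed)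
    then show "x \<otimes> y \<in> local_hull z" using x y by (auto simp: local_hull_def)
  next
    fix x assume "x \<in> local_hull z"
    then obtain i j :: int where x: "x \<in> centralizer z" "lt (z [^] i) x" "lt x (z [^] j)"
      by (auto simp: local_hull_def)
    have [simp]: "x \<in> carrier G" using x by auto
    have invx: "inv x \<in> centralizer z" using x by simp
    \<comment> \<open>Multiplying \<open>z [^] i\<close> and \<open>x\<close> on the left by
      \<open>inv x\<close> and then by \<open>z [^] (- i)\<close> turns the lower bound of
      \<open>x\<close> into an upper bound of \<open>inv x\<close>; likewise with \<open>j\<close>
      for the other bound.\<close>
    have "z [^] (- i) \<otimes> (inv x \<otimes> z [^] i) = inv x" "z [^] (- j) \<otimes> (inv x \<otimes> z [^] j) = inv x"
      unfolding comm[OF invx] using z by (simp_all flip: m_assoc add: int_pow_mult[symmetric])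
    moreover have "lt (z [^] (- i) \<otimes> (inv x \<otimes> z [^] i)) (z [^] (- i) \<otimes> (inv x \<otimes> x))"
      using x z by (intro mult_left_mono) auto
    moreover have "lt (z [^] (- j) \<otimes> (inv x \<otimes> x)) (z [^] (- j) \<otimes> (inv x \<otimes> z [^] j))"
      using x z by (intro mult_left_mono) auto
    ultimately have "lt (inv x) (z [^] (- i))" "lt (z [^] (- j)) (inv x)" using z by auto
    then show "inv x \<in> local_hull z" using invx by (auto simp: local_hull_def)
  qed
qed

text \<open>Counting upwards from a power below \<open>x\<close> leads to a least exponent whose
  power exceeds \<open>x\<close>; \<open>k\<close> is its predecessor.\<close>

lemma archimedean:
  assumes z: "z \<in> carrier G" "lt \<one> z" and x: "x \<in> local_hull z"
  obtains k :: int where "\<not> lt x (z [^] k)" "lt x (z [^] (k + 1))"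
proof -
  obtain i j :: int where ij: "x \<in> carrier G" "lt (z [^] i) x" "lt x (z [^] j)"
    using x by (auto simp: local_hull_def centralizer_def)
  have low: "\<not> lt x (z [^] i)"
    using ij z lt_trans[of x "z [^] i" x] lt_irrefl by auto
  have "i < j"
  proof (rule ccontr)
    assume "\<not> i < j"
    then have "j = i \<or> j < i" by linarith
    then have "j = i \<or> lt (z [^] j) (z [^] i)" using int_pow_strict_mono[OF z(2,1), of j i] by blast
    then show False using low ij z lt_trans[of x "z [^] j" "z [^] i"] by auto
  qed
  then have "\<exists>n::nat. lt x (z [^] (i + int n))" using ij(3) by (intro exI[of _ "nat (j - i)"]) simp
  then obtain n where n: "lt x (z [^] (i + int n))" "\<And>m. m < n \<Longrightarrow> \<not> lt x (z [^] (i + int m))"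
    using exists_least_iff[of "\<lambda>n. lt x (z [^] (i + int n))"] by blast
  have "n > 0" using n(1) low by (cases n) auto
  then show ?thesis using n(1) n(2)[of "n - 1"] by (intro that[of "i + int (n - 1)"]) (auto simp: of_nat_diff)
qed

text \<open>A root commutes with its own power and lies between the powers of \<open>z\<close> with
  exponents 0 and 2.\<close>

lemma root_in_local_hull:
  assumes "w \<in> carrier G" "n > 0" "w [^] (n :: nat) = z" "lt \<one> z"
  shows "w \<in> local_hull z"
proof -
  have w: "lt \<one> w" using assms pos_pow_iff by blast
  have "w [^] n \<otimes> w = w \<otimes> w [^] n" using nat_pow_Suc2[of w n] assms(1) by simp
  then have "w \<in> centralizer z" unfolding assms(3) centralizer_def using assms(1) by simp
  moreover have "lt (z [^] (0 :: int)) w" using w by simp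
  \<comment> \<open>The bound \<open>z\<close> itself would not be strict for \<open>n = 1\<close>;
    with exponent 2 the cofactor \<open>w [^] (n + n - 1)\<close> is always a positive
    power.\<close>
  moreover have "lt w (z [^] (2 :: int))"
  proof -
    have "lt \<one> (w [^] (n + n - 1))" using assms w by (intro pos_pow) auto
    then have "lt (w \<otimes> \<one>) (w \<otimes> w [^] (n + n - 1))" using assms by (intro mult_left_mono) auto
    also have "w \<otimes> w [^] (n + n - 1) = w [^] (n + n)"
      using assms nat_pow_Suc2[of w "n + n - 1"] by simp
    also have "\<dots> = z \<otimes> z" using assms nat_pow_mult[of w n n] by simp
    also have "\<dots> = z [^] (2 :: int)" using assms int_pow_mult[of z 1 1] by auto
    finally show ?thesis using assms by simp
  qed
  ultimately show ?thesis unfolding local_hull_def by blast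
qed

section \<open>Uniqueness of roots and commutativity\<close>

text \<open>By \<open>virt\<close> and \<open>pos_conj\<close>, conjugation within \<open>H\<close>
  preserves positivity. The induction passes through \<open>a [^] n \<otimes> c\<close>, which lies
  between the two powers with exponent \<open>Suc n\<close>. As a consequence, elements of
  \<open>H\<close> with equal \<open>n\<close>-th powers coincide.\<close>

lemma pow_strict_mono:
  assumes H: "subgroup H G" and virt: "\<And>x y. x \<in> H \<Longrightarrow> y \<in> H \<Longrightarrow> \<exists>m>0. x [^] (m :: nat) \<in> centralizer y"
    and a: "a \<in> H" and c: "c \<in> H" and "lt a c" and "n > 0"
  shows "lt (a [^] (n :: nat)) (c [^] n)"
  using \<open>n > 0\<close>
proof (induction n rule: nat_induct_non_zero)
  case 1
  then show ?case using assms subgroup.mem_carrier[OF H] by simp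
next
  case (Suc n)
  interpret H: subgroup H G by fact
  have [simp]: "a \<in> carrier G" "c \<in> carrier G" using a c by auto
  \<comment> \<open>Positivity of \<open>x\<close> encodes the induction hypothesis; conjugating
    \<open>x\<close> by \<open>c\<close> simulates the missing multiplication by \<open>c\<close> on
    the right.\<close>
  define x where "x = inv (a [^] n) \<otimes> c [^] n"
  have "a [^] int n \<in> H" "c [^] int n \<in> H" using a c H by (auto intro: subgroup_int_pow_closed)
  then have x: "x \<in> H" "x \<in> carrier G" by (auto simp: x_def int_pow_int)
  have "lt \<one> x" using Suc.IH mult_left_mono[of "a [^] n" "c [^] n" "inv (a [^] n)"] by (simp add: x_def)
  moreover obtain m where "m > 0" "x [^] (m :: nat) \<in> centralizer c" using virt[OF x(1) c] by blast
  ultimately have "lt \<one> (inv c \<otimes> x \<otimes> c)" using x by (intro pos_conj) (auto simp: centralizer_def)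
  then have "lt (a [^] n \<otimes> c \<otimes> \<one>) (a [^] n \<otimes> c \<otimes> (inv c \<otimes> x \<otimes> c))"
    using x by (intro mult_left_mono) auto
  also have "a [^] n \<otimes> c \<otimes> (inv c \<otimes> x \<otimes> c) = a [^] n \<otimes> (x \<otimes> c)"
  proof -
    have "c \<otimes> (inv c \<otimes> (x \<otimes> c)) = x \<otimes> c" using x(2) by (simp flip: m_assoc)
    then show ?thesis using x(2) by (simp add: m_assoc)
  qed
  also have "\<dots> = c [^] Suc n"
  proof -
    have "a [^] n \<otimes> (inv (a [^] n) \<otimes> (c [^] n \<otimes> c)) = c [^] n \<otimes> c" by (simp flip: m_assoc)
    then show ?thesis by (simp add: x_def m_assoc)
  qed
  finally have "lt (a [^] n \<otimes> c) (c [^] Suc n)" by simp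
  moreover have "lt (a [^] n \<otimes> a) (a [^] n \<otimes> c)" using \<open>lt a c\<close> by (intro mult_left_mono) auto
  ultimately show ?case using lt_trans[of "a [^] n \<otimes> a" "a [^] n \<otimes> c" "c [^] Suc n"] by simp
qed

text \<open>This isolates the algebra: \<open>powers\<close> and \<open>virt\<close> are what
  inp-minimality will supply.\<close>

theorem comm_groupI_power_commuting:
  assumes powers: "\<And>x y. x \<in> carrier G \<Longrightarrow> y \<in> carrier G \<Longrightarrow>
      \<exists>m>0. x [^] (m :: nat) \<in> centralizer y \<or> y [^] m \<in> centralizer x"
    and virt: "\<And>x y z. z \<in> carrier G \<Longrightarrow> lt \<one> z \<Longrightarrow> x \<in> local_hull z \<Longrightarrow> y \<in> local_hull z \<Longrightarrow>
      \<exists>m>0. x [^] (m :: nat) \<in> centralizer y"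
  shows "comm_group G"
proof -
  have pos: "x \<otimes> y = y \<otimes> x"
    if x: "x \<in> carrier G" and y: "y \<in> carrier G" and "lt \<one> x" "n > 0"
      and cent: "x [^] (n :: nat) \<in> centralizer y" for x y n
  proof -
    define z where "z = x [^] n"
    define c where "c = inv y \<otimes> x \<otimes> y"
    have [simp]: "c \<in> carrier G" using x y by (simp add: c_def)
    have z: "z \<in> carrier G" "lt \<one> z" using that pos_pow by (auto simp: z_def)
    have "c [^] n = inv y \<otimes> x [^] n \<otimes> y" unfolding c_def using x y by (rule conj_pow)
    also have "\<dots> = inv y \<otimes> (z \<otimes> y)" using x y by (simp add: z_def m_assoc)
    also have "\<dots> = z" using cent y z by (simp add: z_def[symmetric] centralizer_def) (simp flip: m_assoc)
    finally have cz: "c [^] n = z" .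
    have H: "subgroup (local_hull z) G" "x \<in> local_hull z" "c \<in> local_hull z"
      using local_hull_subgroup[OF z] root_in_local_hull[of _ n z] z \<open>n > 0\<close> x cz by (auto simp: z_def)
    \<comment> \<open>Either inequality would be inherited by the \<open>n\<close>-th powers, which
      are both \<open>z\<close>.\<close>
    have "\<not> lt x c" "\<not> lt c x"
      using pow_strict_mono[OF H(1) virt[OF z], of x c n] pow_strict_mono[OF H(1) virt[OF z], of c x n]
        H \<open>n > 0\<close> cz z lt_irrefl[of z] by (auto simp: z_def)
    then have "x = c" using lt_total[of x c] x by auto
    then have "y \<otimes> x = y \<otimes> (inv y \<otimes> x \<otimes> y)" by (simp add: c_def)
    also have "\<dots> = x \<otimes> y" using x y by (simp flip: m_assoc)
    finally show ?thesis by simp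
  qed
  have comm: "x \<otimes> y = y \<otimes> x"
    if x: "x \<in> carrier G" and y: "y \<in> carrier G" and "n > 0"
      and cent: "x [^] (n :: nat) \<in> centralizer y" for x y n
  proof -
    \<comment> \<open>The centralizer of \<open>y\<close> is a subgroup, so a negative
      \<open>x\<close> may be replaced by its inverse.\<close>
    consider "x = \<one>" | "lt \<one> x" | "lt \<one> (inv x)" using lt_total[of \<one> x] x by (auto simp: pos_inv_iff)
    then show ?thesis
    proof cases
      case 3
      have "inv x [^] n \<in> centralizer y"
        using subgroup.m_inv_closed[OF centralizer_subgroup[OF y] cent] x by (simp add: nat_pow_inv)
      then have "inv x \<otimes> y = y \<otimes> inv x" using pos[of "inv x" y n] 3 that by simp
      then have "inv x \<in> centralizer y" using x by (simp add: centralizer_def)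
      from subgroup.m_inv_closed[OF centralizer_subgroup[OF y] this] show ?thesis
        using x by (simp add: centralizer_def)
    qed (use pos that in auto)
  qed
  show ?thesis
  proof (rule group_comm_groupI)
    fix x y assume xy: "x \<in> carrier G" "y \<in> carrier G"
    from powers[OF this] obtain m :: nat where "m > 0" "x [^] m \<in> centralizer y \<or> y [^] m \<in> centralizer x" by blast
    then show "x \<otimes> y = y \<otimes> x" using comm[of x y m] comm[of y x m] xy by auto
  qed
qed

section \<open>Disjointness of cosets and of intervals between powers\<close>

text \<open>A point common to the cosets of \<open>x [^] i\<close> and \<open>x [^] j\<close> with
  \<open>i < j\<close> would put \<open>x [^] (j - i)\<close> into \<open>H\<close>. The factor
  \<open>\<one>\<close> gives the set the two-sided shape of the definable families.\<close>

lemma disjoint_family_left_cosets: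
  assumes "subgroup H G" and [simp]: "x \<in> carrier G" and "\<And>m. m > 0 \<Longrightarrow> x [^] (m :: nat) \<notin> H"
  shows "disjoint_family (\<lambda>i :: nat. {w \<in> carrier G. inv (x [^] i) \<otimes> w \<otimes> \<one> \<in> H})"
proof -
  interpret H: subgroup H G by fact
  have False if "i < j" and [simp]: "w \<in> carrier G"
    and "inv (x [^] i) \<otimes> w \<in> H" "inv (x [^] j) \<otimes> w \<in> H" for i j :: nat and w
  proof -
    have "inv (x [^] i) \<otimes> w \<otimes> inv (inv (x [^] j) \<otimes> w) \<in> H" using that by simp
    also have "inv (x [^] i) \<otimes> w \<otimes> inv (inv (x [^] j) \<otimes> w) = inv (x [^] i) \<otimes> x [^] j"
    proof -
      have "w \<otimes> (inv w \<otimes> x [^] j) = x [^] j" by (simp flip: m_assoc)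
      then show ?thesis by (simp add: inv_mult_group m_assoc)
    qed
    also have "\<dots> = inv (x [^] i) \<otimes> (x [^] i \<otimes> x [^] (j - i))"
      using \<open>i < j\<close> by (simp add: nat_pow_mult)
    also have "\<dots> = x [^] (j - i)" by (simp flip: m_assoc)
    finally show False using assms(3) \<open>i < j\<close> by simp
  qed
  then show ?thesis unfolding disjoint_family_on_def
    by (auto simp: neq_iff)
qed

text \<open>Mirror image of the argument for left cosets, with the quotient of the two memberships
  formed on the other side.\<close>

lemma disjoint_family_right_cosets:
  assumes "subgroup H G" and [simp]: "y \<in> carrier G" and "\<And>m. m > 0 \<Longrightarrow> y [^] (m :: nat) \<notin> H"
  shows "disjoint_family (\<lambda>i :: nat. {w \<in> carrier G. \<one> \<otimes> w \<otimes> inv (y [^] i) \<in> H})"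
proof -
  interpret H: subgroup H G by fact
  have False if "i < j" and [simp]: "w \<in> carrier G"
    and "w \<otimes> inv (y [^] i) \<in> H" "w \<otimes> inv (y [^] j) \<in> H" for i j :: nat and w
  proof -
    have "inv (w \<otimes> inv (y [^] j)) \<otimes> (w \<otimes> inv (y [^] i)) \<in> H" using that by simp
    also have "inv (w \<otimes> inv (y [^] j)) \<otimes> (w \<otimes> inv (y [^] i)) = y [^] j \<otimes> inv (y [^] i)"
    proof -
      have "inv w \<otimes> (w \<otimes> inv (y [^] i)) = inv (y [^] i)" by (simp flip: m_assoc)
      then show ?thesis by (simp add: inv_mult_group m_assoc)
    qed
    also have "\<dots> = (y [^] (j - i) \<otimes> y [^] i) \<otimes> inv (y [^] i)"
      using \<open>i < j\<close> by (simp add: nat_pow_mult)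
    also have "\<dots> = y [^] (j - i)" by (simp add: m_assoc)
    finally show False using assms(3) \<open>i < j\<close> by simp
  qed
  then show ?thesis unfolding disjoint_family_on_def
    by (auto simp: neq_iff)
qed

text \<open>For \<open>i < j\<close> the right end of the earlier interval is at most the left end
  of the later one, and the right end is excluded.\<close>

lemma disjoint_family_power_intervals:
  assumes z: "z \<in> carrier G" "lt \<one> z"
  shows "disjoint_family
    (\<lambda>j :: nat. {w \<in> carrier G. \<not> lt w (z [^] int j) \<and> lt w (z [^] (int j + 1))})"
proof -
  have False if "i < j" "w \<in> carrier G" "lt w (z [^] (int i + 1))" "\<not> lt w (z [^] int j)"
    for i j :: nat and w
  proof -
    have "int i + 1 = int j \<or> int i + 1 < int j" using \<open>i < j\<close> by linarith
    then show False
      using that z int_pow_strict_mono[OF z(2,1), of "int i + 1" "int j"]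
        lt_trans[of w "z [^] (int i + 1)" "z [^] int j"] by auto
  qed
  then show ?thesis unfolding disjoint_family_on_def
    by (auto simp: neq_iff)
qed

end

section \<open>Inp-minimality applied to cosets and intervals\<close>

theorem theorem2p6:
  fixes L :: "('f, 'r) language"
    and M :: "('a, 'f, 'r) fo_struct"
    and G :: "'a monoid"
    and lt :: "'a \<Rightarrow> 'a \<Rightarrow> bool"
  assumes "is_struct L M"
    and "group G"
    and "carrier G = univ M"
    and "definable L M 3 {[x, y, x \<otimes>\<^bsub>G\<^esub> y] | x y. x \<in> univ M \<and> y \<in> univ M}"
    and "left_ordering G lt"
    and "definable L M 2 {[x, y] | x y. x \<in> univ M \<and> y \<in> univ M \<and> lt x y}"
    and "inp_minimal L (Th L M)"
  shows "comm_group G"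
proof -
  interpret left_ordered_group G lt
    using assms(2,5) by (simp add: left_ordered_group_def left_ordered_group_axioms_def)
  note meet = inp_minimal_definable_families[OF assms(1,7)]
  have centralizer_family:
    "definable_family L M (\<lambda>j. {x \<in> carrier G. p j \<otimes>\<^bsub>G\<^esub> x \<otimes>\<^bsub>G\<^esub> q j \<in> centralizer b})"
    if "\<And>j. p j \<in> carrier G" "\<And>j. q j \<in> carrier G" "b \<in> carrier G" for p q :: "nat \<Rightarrow> 'a" and b
  proof -
    have "{x \<in> carrier G. p j \<otimes>\<^bsub>G\<^esub> x \<otimes>\<^bsub>G\<^esub> q j \<in> centralizer b} =
        {x \<in> carrier G. (p j \<otimes>\<^bsub>G\<^esub> x \<otimes>\<^bsub>G\<^esub> q j) \<otimes>\<^bsub>G\<^esub> b = b \<otimes>\<^bsub>G\<^esub> (p j \<otimes>\<^bsub>G\<^esub> x \<otimes>\<^bsub>G\<^esub> q j)}" for j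
      using that unfolding centralizer_def by blast
    then show ?thesis using definable_family_commuting[OF assms(2-4) that] by simp
  qed
  show ?thesis
  proof (rule comm_groupI_power_commuting)
    fix x y assume [simp]: "x \<in> carrier G" "y \<in> carrier G"
    show "\<exists>m>0. x [^]\<^bsub>G\<^esub> (m :: nat) \<in> centralizer y \<or> y [^]\<^bsub>G\<^esub> m \<in> centralizer x"
    proof (rule ccontr)
      assume "\<not> ?thesis"
      then have "\<And>m. m > 0 \<Longrightarrow> x [^]\<^bsub>G\<^esub> (m :: nat) \<notin> centralizer y"
        "\<And>m. m > 0 \<Longrightarrow> y [^]\<^bsub>G\<^esub> (m :: nat) \<notin> centralizer x"
        by blast+
      then have "disjoint_family (\<lambda>i :: nat. {w \<in> carrier G. inv\<^bsub>G\<^esub> (x [^]\<^bsub>G\<^esub> i) \<otimes>\<^bsub>G\<^esub> w \<otimes>\<^bsub>G\<^esub> \<one>\<^bsub>G\<^esub> \<in> centralizer y})"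
        "disjoint_family (\<lambda>j :: nat. {w \<in> carrier G. \<one>\<^bsub>G\<^esub> \<otimes>\<^bsub>G\<^esub> w \<otimes>\<^bsub>G\<^esub> inv\<^bsub>G\<^esub> (y [^]\<^bsub>G\<^esub> j) \<in> centralizer x})"
        by (simp_all add: disjoint_family_left_cosets disjoint_family_right_cosets centralizer_subgroup)
      from meet[OF centralizer_family this(1) centralizer_family this(2)] obtain i j :: nat where
        empty: "{w \<in> carrier G. inv\<^bsub>G\<^esub> (x [^]\<^bsub>G\<^esub> i) \<otimes>\<^bsub>G\<^esub> w \<otimes>\<^bsub>G\<^esub> \<one>\<^bsub>G\<^esub> \<in> centralizer y} \<inter>
          {w \<in> carrier G. \<one>\<^bsub>G\<^esub> \<otimes>\<^bsub>G\<^esub> w \<otimes>\<^bsub>G\<^esub> inv\<^bsub>G\<^esub> (y [^]\<^bsub>G\<^esub> j) \<in> centralizer x} = {}"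
        by auto
      \<comment> \<open>The point shared by the left coset of \<open>x [^] i\<close> and the right
        coset of \<open>y [^] j\<close>.\<close>
      define w where "w = x [^]\<^bsub>G\<^esub> i \<otimes>\<^bsub>G\<^esub> y [^]\<^bsub>G\<^esub> j"
      have "inv\<^bsub>G\<^esub> (x [^]\<^bsub>G\<^esub> i) \<otimes>\<^bsub>G\<^esub> w \<otimes>\<^bsub>G\<^esub> \<one>\<^bsub>G\<^esub> = y [^]\<^bsub>G\<^esub> j"
        by (simp add: w_def flip: m_assoc)
      moreover have "\<one>\<^bsub>G\<^esub> \<otimes>\<^bsub>G\<^esub> w \<otimes>\<^bsub>G\<^esub> inv\<^bsub>G\<^esub> (y [^]\<^bsub>G\<^esub> j) = x [^]\<^bsub>G\<^esub> i"
        by (simp add: w_def m_assoc)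
      moreover have "u [^]\<^bsub>G\<^esub> k \<in> centralizer u" if "u \<in> carrier G" for u and k :: nat
        using that nat_pow_Suc2[of u k] by (simp add: centralizer_def)
      ultimately have "w \<in> {w \<in> carrier G. inv\<^bsub>G\<^esub> (x [^]\<^bsub>G\<^esub> i) \<otimes>\<^bsub>G\<^esub> w \<otimes>\<^bsub>G\<^esub> \<one>\<^bsub>G\<^esub> \<in> centralizer y} \<inter>
          {w \<in> carrier G. \<one>\<^bsub>G\<^esub> \<otimes>\<^bsub>G\<^esub> w \<otimes>\<^bsub>G\<^esub> inv\<^bsub>G\<^esub> (y [^]\<^bsub>G\<^esub> j) \<in> centralizer x}"
        by (simp add: w_def)
      then show False unfolding empty by simp
    qed
  next
    fix x y z assume z: "z \<in> carrier G" "lt \<one>\<^bsub>G\<^esub> z" and x: "x \<in> local_hull z" and y: "y \<in> local_hull z"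
    have y_cent: "y \<in> centralizer z" using y by (simp add: local_hull_def)
    have [simp]: "x \<in> carrier G" "y \<in> carrier G"
      using x y subgroup.mem_carrier[OF local_hull_subgroup[OF z]] by auto
    show "\<exists>m>0. x [^]\<^bsub>G\<^esub> (m :: nat) \<in> centralizer y"
    proof (rule ccontr)
      assume "\<not> ?thesis"
      then have "\<And>m. m > 0 \<Longrightarrow> x [^]\<^bsub>G\<^esub> (m :: nat) \<notin> centralizer y" by blast
      then have disj: "disjoint_family (\<lambda>i :: nat. {w \<in> carrier G. inv\<^bsub>G\<^esub> (x [^]\<^bsub>G\<^esub> i) \<otimes>\<^bsub>G\<^esub> w \<otimes>\<^bsub>G\<^esub> \<one>\<^bsub>G\<^esub> \<in> centralizer y})"
        by (simp add: disjoint_family_left_cosets centralizer_subgroup)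
      have "definable_family L M (\<lambda>j :: nat.
          {w \<in> carrier G. \<not> lt w (z [^]\<^bsub>G\<^esub> int j) \<and> lt w (z [^]\<^bsub>G\<^esub> (int j + 1))})"
        unfolding assms(3)
        by (intro definable_family_half_open_interval assms(6)) (use z in \<open>simp_all flip: assms(3)\<close>)
      from meet[OF centralizer_family disj this disjoint_family_power_intervals[OF z]] obtain i j :: nat where
        empty: "{w \<in> carrier G. inv\<^bsub>G\<^esub> (x [^]\<^bsub>G\<^esub> i) \<otimes>\<^bsub>G\<^esub> w \<otimes>\<^bsub>G\<^esub> \<one>\<^bsub>G\<^esub> \<in> centralizer y} \<inter>
          {w \<in> carrier G. \<not> lt w (z [^]\<^bsub>G\<^esub> int j) \<and> lt w (z [^]\<^bsub>G\<^esub> (int j + 1))} = {}"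
        by auto
      have "x [^]\<^bsub>G\<^esub> int i \<in> local_hull z"
        using x local_hull_subgroup[OF z] by (intro subgroup_int_pow_closed)
      then have xi: "x [^]\<^bsub>G\<^esub> i \<in> local_hull z" by (simp add: int_pow_int)
      obtain k :: int where k: "\<not> lt (x [^]\<^bsub>G\<^esub> i) (z [^]\<^bsub>G\<^esub> k)" "lt (x [^]\<^bsub>G\<^esub> i) (z [^]\<^bsub>G\<^esub> (k + 1))"
        using archimedean[OF z xi] .
      \<comment> \<open>Translation by \<open>s\<close> carries the interval starting at
        \<open>z [^] k\<close>, which contains \<open>x [^] i\<close>, to the \<open>j\<close>-th
        one. As a power of \<open>z\<close>, \<open>s\<close> commutes with \<open>y\<close>, so
        multiplying by it on the right stays in the coset. It also commutes with
        \<open>x [^] i\<close>, so the same product is a left translate and left invariance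
        applies.\<close>
      define s where "s = z [^]\<^bsub>G\<^esub> (int j - k)"
      have [simp]: "s \<in> carrier G" using z by (simp add: s_def)
      have "x [^]\<^bsub>G\<^esub> i \<in> centralizer z" using xi by (simp add: local_hull_def)
      then have "s \<in> centralizer (x [^]\<^bsub>G\<^esub> i)"
        using centralizer_int_pow[OF centralizer_sym[OF _ z(1)]] by (simp add: s_def)
      then have comm: "s \<otimes>\<^bsub>G\<^esub> x [^]\<^bsub>G\<^esub> i = x [^]\<^bsub>G\<^esub> i \<otimes>\<^bsub>G\<^esub> s" unfolding centralizer_def by blast
      define w where "w = x [^]\<^bsub>G\<^esub> i \<otimes>\<^bsub>G\<^esub> s"
      have "inv\<^bsub>G\<^esub> (x [^]\<^bsub>G\<^esub> i) \<otimes>\<^bsub>G\<^esub> w \<otimes>\<^bsub>G\<^esub> \<one>\<^bsub>G\<^esub> = s" by (simp add: w_def flip: m_assoc)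
      moreover have "s \<in> centralizer y"
        using centralizer_int_pow[OF centralizer_sym[OF y_cent z(1)]] by (simp add: s_def)
      moreover have "s \<otimes>\<^bsub>G\<^esub> z [^]\<^bsub>G\<^esub> k = z [^]\<^bsub>G\<^esub> int j" "s \<otimes>\<^bsub>G\<^esub> z [^]\<^bsub>G\<^esub> (k + 1) = z [^]\<^bsub>G\<^esub> (int j + 1)"
        using z unfolding s_def by (simp_all flip: int_pow_mult)
      then have "\<not> lt w (z [^]\<^bsub>G\<^esub> int j)" "lt w (z [^]\<^bsub>G\<^esub> (int j + 1))"
        using k z lt_mult_left_iff[of s "x [^]\<^bsub>G\<^esub> i" "z [^]\<^bsub>G\<^esub> k"]
          lt_mult_left_iff[of s "x [^]\<^bsub>G\<^esub> i" "z [^]\<^bsub>G\<^esub> (k + 1)"]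
        unfolding w_def comm[symmetric] by simp_all
      moreover have "w \<in> carrier G" by (simp add: w_def)
      ultimately have "w \<in> {w \<in> carrier G. inv\<^bsub>G\<^esub> (x [^]\<^bsub>G\<^esub> i) \<otimes>\<^bsub>G\<^esub> w \<otimes>\<^bsub>G\<^esub> \<one>\<^bsub>G\<^esub> \<in> centralizer y} \<inter>
          {w \<in> carrier G. \<not> lt w (z [^]\<^bsub>G\<^esub> int j) \<and> lt w (z [^]\<^bsub>G\<^esub> (int j + 1))}"
        by simp
      then show False unfolding empty by simp
    qed
  qed
qed

end
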